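(* Assume the setting and standing assumption described in the context. Suppose that for all $t\ge t_0$ $$1+\theta-\theta t\alpha(t)\le 0,\qquad (2\theta-1)\beta(t)+\theta t\dot\beta(t)\le 0,\qquad \alpha(t)+t\dot\alpha(t)\le t\beta(t)\epsilon(t),$$ and that $\int_{t_0}^{+\infty}\frac{\beta(t)\epsilon(t)}{t}\,\mathrm{d}t<+\infty$. Then, for any trajectory $(x(t),y(t))$ of the system (GTRD) and any saddle point $(x^*,y^* )\in\Omega$, the following hold. (1) If there exists a constant $D_2>0$ such that $D_2\le\theta t\alpha(t)-\theta-1$ for all $t\ge t_0$, then $\lim_{t\to+\infty}\|\dot x(t)\|=0$ and $\lim_{t\to+\infty}\|\dot y(t)\|=0$. (2) If $\liminf_{t\to+\infty}\beta(t)>0$, then $$\lim_{t\to+\infty}\left(\mathcal{L}(x(t),y^* )-\mathcal{L}(x^*,y(t))\right)=0.$$ In particular, if $\lim_{t\to+\infty}\beta(t)=+\infty$, then, as $t\to+\infty$, $$\mathcal{L}(x(t),y^* )-\mathcal{L}(x^*,y(t))=o\left(\frac{1}{\beta(t)}\right),$$ $$\|\nabla f(x(t))-\nabla f(x^* )\|=o\left(\frac{1}{\sqrt{\beta(t)}}\right),\qquad \|\nabla g(y(t))-\nabla g(y^* )\|=o\left(\frac{1}{\sqrt{\beta(t)}}\right).$$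
   Context: Standing assumption: $f:\mathbb{R}^n\to\mathbb{R}$ and $g:\mathbb{R}^m\to\mathbb{R}$ are continuously differentiable convex functions whose gradients $\nabla f$, $\nabla g$ are $L_1$- and $L_2$-Lipschitz continuous, respectively, with $L_1,L_2>0$; $K\in\mathbb{R}^{m\times n}$ with adjoint $K^*$; $t_0>0$ and $\theta>0$ are constants; $\alpha,\beta,\epsilon:[t_0,+\infty)\to(0,+\infty)$ are of class $\mathcal{C}^1$, and $\epsilon$ is nonincreasing with $\lim_{t\to+\infty}\epsilon(t)=0$. Norms and inner products are Euclidean. Lagrangian: $\mathcal{L}(x,y)=f(x)+\langle Kx,y\rangle-g(y)$ on $\mathbb{R}^n\times\mathbb{R}^m$. A pair $(x^*,y^* )$ is a saddle point of $\mathcal{L}$ if $\mathcal{L}(x^*,y)\le\mathcal{L}(x^*,y^* )\le\mathcal{L}(x,y^* )$ for all $(x,y)\in\mathbb{R}^n\times\mathbb{R}^m$; $\Omega$ is the set of saddle points. Regularized function: $\mathcal{L}_t(x,y)=\mathcal{L}(x,y)+\frac{\epsilon(t)}{2}(\|x\|^2-\|y\|^2)$. System (GTRD), for $t\ge t_0$: $$\ddot x(t)+\alpha(t)\dot x(t)+\beta(t)\nabla_x\mathcal{L}_t\big(x(t),y(t)+\theta t\dot y(t)\big)=0,$$ $$\ddot y(t)+\alpha(t)\dot y(t)-\beta(t)\nabla_y\mathcal{L}_t\big(x(t)+\theta t\dot x(t),y(t)\big)=0,$$ where $\nabla_x\mathcal{L}_t(x,y)=\nabla f(x)+K^*y+\epsilon(t)x$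 and $\nabla_y\mathcal{L}_t(x,y)=-\nabla g(y)+Kx-\epsilon(t)y$. A trajectory is a global strong solution: $x\in W^{2,1}_{\mathrm{loc}}([t_0,+\infty);\mathbb{R}^n)$, $y\in W^{2,1}_{\mathrm{loc}}([t_0,+\infty);\mathbb{R}^m)$, satisfying the system for almost every $t>t_0$. *)

theory Defs
  imports "HOL-Analysis.Analysis" "HOL-Library.Landau_Symbols"
begin

definition gradient :: "('a::real_inner \<Rightarrow> real) \<Rightarrow> 'a \<Rightarrow> 'a" where
  "gradient f x = (THE d. GDERIV f x :> d)"

definition C1_convex :: "('a::real_inner \<Rightarrow> real) \<Rightarrow> bool" where
  "C1_convex f \<longleftrightarrow>
     convex_on UNIV f \<and> (\<forall>x. f differentiable (at x)) \<and> continuous_on UNIV (gradient f)"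

(* Derivative on the half-line [t0, +oo): one-sided at t0, so that nothing is
   required of u to the left of t0. *)
definition deriv_from :: "real \<Rightarrow> (real \<Rightarrow> real) \<Rightarrow> real \<Rightarrow> real" where
  "deriv_from t0 u t = vector_derivative u (at t within {t0..})"

definition C1_from :: "real \<Rightarrow> (real \<Rightarrow> real) \<Rightarrow> bool" where
  "C1_from t0 u \<longleftrightarrow>
     (\<forall>t\<ge>t0. u differentiable (at t within {t0..})) \<and>
     continuous_on {t0..} (deriv_from t0 u)"

definition lagrangian ::
  "(real^'n \<Rightarrow> real) \<Rightarrow> (real^'m \<Rightarrow> real) \<Rightarrow> real^'n^'m \<Rightarrow> real^'n \<Rightarrow> real^'m \<Rightarrow> real" where
  "lagrangian f g K x y = f x + (K *v x) \<bullet> y - g y"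

definition saddle_points ::
  "(real^'n \<Rightarrow> real) \<Rightarrow> (real^'m \<Rightarrow> real) \<Rightarrow> real^'n^'m \<Rightarrow> ((real^'n) \<times> (real^'m)) set" where
  "saddle_points f g K = {(xs, ys).
     \<forall>x y. lagrangian f g K xs y \<le> lagrangian f g K xs ys \<and>
           lagrangian f g K xs ys \<le> lagrangian f g K x ys}"

definition reg_lagrangian ::
  "(real^'n \<Rightarrow> real) \<Rightarrow> (real^'m \<Rightarrow> real) \<Rightarrow> real^'n^'m \<Rightarrow> (real \<Rightarrow> real) \<Rightarrow> real
     \<Rightarrow> real^'n \<Rightarrow> real^'m \<Rightarrow> real" where
  "reg_lagrangian f g K \<epsilon> t x y =
     lagrangian f g K x y + \<epsilon> t / 2 * ((norm x)\<^sup>2 - (norm y)\<^sup>2)"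

definition grad_x ::
  "(real^'n \<Rightarrow> real) \<Rightarrow> (real^'m \<Rightarrow> real) \<Rightarrow> real^'n^'m \<Rightarrow> (real \<Rightarrow> real) \<Rightarrow> real
     \<Rightarrow> real^'n \<Rightarrow> real^'m \<Rightarrow> real^'n" where
  "grad_x f g K \<epsilon> t x y = gradient (\<lambda>u. reg_lagrangian f g K \<epsilon> t u y) x"

definition grad_y ::
  "(real^'n \<Rightarrow> real) \<Rightarrow> (real^'m \<Rightarrow> real) \<Rightarrow> real^'n^'m \<Rightarrow> (real \<Rightarrow> real) \<Rightarrow> real
     \<Rightarrow> real^'n \<Rightarrow> real^'m \<Rightarrow> real^'m" where
  "grad_y f g K \<epsilon> t x y = gradient (\<lambda>v. reg_lagrangian f g K \<epsilon> t x v) y"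

lemma gradient_eqI: "GDERIV f x :> d \<Longrightarrow> gradient f x = d"
  unfolding gradient_def
proof (rule the_equality)
  fix e assume "GDERIV f x :> d" "GDERIV f x :> e"
  then have "(\<lambda>h. h \<bullet> e) = (\<lambda>h. h \<bullet> d)"
    unfolding gderiv_def by (rule has_derivative_unique[rotated])
  then have "\<forall>h. h \<bullet> e = h \<bullet> d" by (simp add: fun_eq_iff)
  then show "e = d" by (simp only: vector_eq_ldot)
qed

lemma GDERIV_gradient:
  fixes f :: "'a::euclidean_space \<Rightarrow> real"
  assumes "f differentiable (at x)"
  shows "GDERIV f x :> gradient f x"
proof -
  obtain F where F: "(f has_derivative F) (at x)"
    using assms by (auto simp: differentiable_def)
  then have "F h = h \<bullet> adjoint F 1" for h
    using adjoint_works[OF has_derivative_linear[OF F], of h 1] by simp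
  then have "F = (\<lambda>h. h \<bullet> adjoint F 1)" by (rule ext)
  then have "GDERIV f x :> adjoint F 1"
    using F unfolding gderiv_def by simp
  then show ?thesis
    using gradient_eqI by metis
qed

lemma grad_x_eq:
  assumes "f differentiable (at x)"
  shows "grad_x f g K \<epsilon> t x y = gradient f x + adjoint ((*v) K) y + \<epsilon> t *\<^sub>R x"
  unfolding grad_x_def reg_lagrangian_def lagrangian_def power2_norm_eq_inner
proof (rule gradient_eqI, unfold gderiv_def)
  have "((\<lambda>u. K *v u) has_derivative (\<lambda>h. K *v h)) (at x)"
    by (simp add: bounded_linear_imp_has_derivative)
  then show "((\<lambda>u. f u + (K *v u) \<bullet> y - g y + \<epsilon> t / 2 * (u \<bullet> u - y \<bullet> y)) has_derivative
    (\<lambda>h. h \<bullet> (gradient f x + adjoint ((*v) K) y + \<epsilon> t *\<^sub>R x))) (at x)"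
    using GDERIV_gradient[OF assms, unfolded gderiv_def]
    by (auto intro!: derivative_eq_intros
        simp: adjoint_works inner_add_right inner_commute algebra_simps)
qed

lemma grad_y_eq:
  assumes "g differentiable (at y)"
  shows "grad_y f g K \<epsilon> t x y = - gradient g y + K *v x - \<epsilon> t *\<^sub>R y"
  unfolding grad_y_def reg_lagrangian_def lagrangian_def power2_norm_eq_inner
proof (rule gradient_eqI, unfold gderiv_def)
  show "((\<lambda>v. f x + (K *v x) \<bullet> v - g v + \<epsilon> t / 2 * (x \<bullet> x - v \<bullet> v)) has_derivative
    (\<lambda>h. h \<bullet> (- gradient g y + K *v x - \<epsilon> t *\<^sub>R y))) (at y)"
    using GDERIV_gradient[OF assms, unfolded gderiv_def]
    by (auto intro!: derivative_eq_intros
        simp: inner_add_right inner_diff_right inner_commute algebra_simps)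
qed

definition L1_loc :: "real \<Rightarrow> (real \<Rightarrow> 'a::euclidean_space) \<Rightarrow> bool" where
  "L1_loc t0 u \<longleftrightarrow> (\<forall>T\<ge>t0. u absolutely_integrable_on {t0..T})"

(* Test functions: continuously differentiable with compact support in the open
   half-line (t0, +oo).  For locally integrable functions these define the same weak
   derivatives as smooth test functions. *)
definition test_function :: "real \<Rightarrow> (real \<Rightarrow> real) \<Rightarrow> bool" where
  "test_function t0 \<phi> \<longleftrightarrow> \<phi> C1_differentiable_on UNIV \<and>
     (\<exists>a b. t0 < a \<and> (\<forall>t. t \<notin> {a..b} \<longrightarrow> \<phi> t = 0))"

definition weak_derivative ::
  "real \<Rightarrow> (real \<Rightarrow> 'a::euclidean_space) \<Rightarrow> (real \<Rightarrow> 'a) \<Rightarrow> bool" where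
  "weak_derivative t0 u v \<longleftrightarrow> (\<forall>\<phi>. test_function t0 \<phi> \<longrightarrow>
     integral {t0..} (\<lambda>t. deriv \<phi> t *\<^sub>R u t) = - integral {t0..} (\<lambda>t. \<phi> t *\<^sub>R v t))"

(* u is in W^{2,1}_loc on [t0, +oo), with first and second weak derivatives v and w.
   An element of this space has a unique representative that is continuous together
   with its derivative; u and v are taken to be these representatives, so that
   their pointwise values make sense. *)
definition W21_loc ::
  "real \<Rightarrow> (real \<Rightarrow> 'a::euclidean_space) \<Rightarrow> (real \<Rightarrow> 'a) \<Rightarrow> (real \<Rightarrow> 'a) \<Rightarrow> bool" where
  "W21_loc t0 u v w \<longleftrightarrow>
     L1_loc t0 u \<and> L1_loc t0 v \<and> L1_loc t0 w \<and>
     weak_derivative t0 u v \<and> weak_derivative t0 v w \<and>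
     continuous_on {t0..} u \<and> continuous_on {t0..} v"

(* (x, y) is a global strong solution; x', y' and x'', y'' are its first and second
   derivatives. *)
definition GTRD_trajectory ::
  "(real^'n \<Rightarrow> real) \<Rightarrow> (real^'m \<Rightarrow> real) \<Rightarrow> real^'n^'m \<Rightarrow>
   (real \<Rightarrow> real) \<Rightarrow> (real \<Rightarrow> real) \<Rightarrow> (real \<Rightarrow> real) \<Rightarrow> real \<Rightarrow> real \<Rightarrow>
   (real \<Rightarrow> real^'n) \<Rightarrow> (real \<Rightarrow> real^'n) \<Rightarrow> (real \<Rightarrow> real^'n) \<Rightarrow>
   (real \<Rightarrow> real^'m) \<Rightarrow> (real \<Rightarrow> real^'m) \<Rightarrow> (real \<Rightarrow> real^'m) \<Rightarrow> bool" where
  "GTRD_trajectory f g K \<alpha> \<beta> \<epsilon> \<theta> t0 x x' x'' y y' y'' \<longleftrightarrow>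
     W21_loc t0 x x' x'' \<and> W21_loc t0 y y' y'' \<and>
     (AE t in lebesgue. t > t0 \<longrightarrow>
        x'' t + \<alpha> t *\<^sub>R x' t
          + \<beta> t *\<^sub>R grad_x f g K \<epsilon> t (x t) (y t + (\<theta> * t) *\<^sub>R y' t) = 0 \<and>
        y'' t + \<alpha> t *\<^sub>R y' t
          - \<beta> t *\<^sub>R grad_y f g K \<epsilon> t (x t + (\<theta> * t) *\<^sub>R x' t) (y t) = 0)"

end

theory Submission
  imports Defs
begin

text \<open>
  Let \<open>M(t) = L(x(t), ys) - L(xs, y(t))\<close>, which is nonnegative because \<open>(xs, ys)\<close> is a saddle point, and
  let \<open>N = M + \<epsilon>/2 (|x|\<^sup>2 + |y|\<^sup>2)\<close>.  Everything follows from one Lyapunov function,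

    \<open>E(t) = \<theta>\<^sup>2 t\<^sup>2 \<beta> N + (|u|\<^sup>2 + |v|\<^sup>2) / 2 + (\<theta> t \<alpha> - \<theta> - 1) / 2 (|x - xs|\<^sup>2 + |y - ys|\<^sup>2)\<close>,

  where \<open>u = x - xs + \<theta> t x'\<close> and \<open>v = y - ys + \<theta> t y'\<close>.  All its terms are nonnegative, and the
  equations, convexity and the three conditions on the parameters give \<open>E' \<le> C t \<beta> \<epsilon>\<close> almost
  everywhere, with \<open>C = \<theta>/2 (|xs|\<^sup>2 + |ys|\<^sup>2)\<close> (\<open>energy_slope_le\<close>).  Hence
  \<open>E(t) \<le> E(T) + C t\<^sup>2 \<integral> \<beta> \<epsilon> / s ds\<close> with the integral over \<open>[T, t]\<close>.  As \<open>\<beta> \<epsilon> / s\<close> is integrable at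
  infinity, \<open>E(t) / t\<^sup>2\<close> tends to 0 (\<open>energy_over_square_tendsto_0\<close>).

  The first term of \<open>E\<close> now gives \<open>\<beta> M \<longlonglongrightarrow> 0\<close>, which contains both statements on the gap.  The function
  \<open>L(-, ys)\<close> is minimal at \<open>xs\<close> and \<open>L(xs, -)\<close> is maximal at \<open>ys\<close>, so the squared distances of the gradients
  are at most \<open>2 L1 M\<close> and \<open>2 L2 M\<close> (\<open>norm_gradient_le_gap\<close>); this gives the rates for the gradients.
  Finally \<open>|u| / t\<close> tends to 0, and under the additional lower bound \<open>D2\<close> so does \<open>|x - xs| / t\<close>; hence
  \<open>x'\<close> tends to 0, and likewise \<open>y'\<close>.

  The trajectory is only given through weak derivatives.  The first two sections show that a
  continuous function is the integral of its weak derivative (\<open>weak_derivative_has_integral\<close>), and that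
  functions which are integrals obey the product rule (\<open>ac_deriv_on_bilinear\<close>).  This allows one to
  integrate \<open>E'\<close> although \<open>x'\<close> and \<open>y'\<close> are differentiable only almost everywhere.
\<close>

section \<open>Integrals of weak derivatives\<close>

text \<open>The hat function with nodes 0, 1, 2, of mass 1.  It is the derivative of the
  quadratic spline \<open>ramp\<close> below, which rises from 0 to 1.\<close>
definition tent :: "real \<Rightarrow> real" where
  "tent t = max 0 t - 2 * max 0 (t - 1) + max 0 (t - 2)"

text \<open>The positive parts make \<open>ramp\<close> a \<open>C\<^sup>1\<close> function on the whole line: it vanishes for
  \<open>t \<le> 0\<close> and equals 1 for \<open>t \<ge> 2\<close>.\<close>
definition ramp :: "real \<Rightarrow> real" where
  "ramp t = ((max 0 t)\<^sup>2 - 2 * (max 0 (t - 1))\<^sup>2 + (max 0 (t - 2))\<^sup>2) / 2"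

lemma DERIV_pos_part_power2:
  "((\<lambda>t::real. (max 0 t)\<^sup>2) has_real_derivative 2 * max 0 t) (at t)"
proof -
  consider "t > 0" | "t < 0" | "t = 0" by linarith
  then show ?thesis
  proof cases
    case 1
    have "((\<lambda>t::real. t\<^sup>2) has_real_derivative 2 * max 0 t) (at t)"
      using 1 by (auto intro!: derivative_eq_intros)
    then show ?thesis
      by (rule has_field_derivative_transform_within_open[where S = "{0<..}"]) (use 1 in auto)
  next
    case 2
    have "((\<lambda>t::real. 0) has_real_derivative 2 * max 0 t) (at t)"
      using 2 by (auto intro!: derivative_eq_intros)
    then show ?thesis
      by (rule has_field_derivative_transform_within_open[where S = "{..<0}"]) (use 2 in auto)
  next
    case 3
    have "((\<lambda>h::real. max 0 h) \<longlongrightarrow> max 0 0) (at 0)"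
      by (intro tendsto_intros)
    moreover have "\<forall>\<^sub>F h::real in at 0. max 0 h = ((max 0 (0 + h))\<^sup>2 - (max 0 0)\<^sup>2) / h"
      by (auto simp: eventually_at_filter max_def power2_eq_square)
    ultimately have "((\<lambda>h::real. ((max 0 (0 + h))\<^sup>2 - (max 0 0)\<^sup>2) / h) \<longlongrightarrow> max 0 0) (at 0)"
      by (rule Lim_transform_eventually)
    then show ?thesis
      using 3 by (simp add: DERIV_def)
  qed
qed

lemma DERIV_ramp: "(ramp has_real_derivative tent t) (at t)"
proof -
  have *: "((\<lambda>t. (max 0 (t - c))\<^sup>2) has_real_derivative 2 * max 0 (t - c)) (at t)" for c :: real
  proof -
    have "((\<lambda>t. t - c) has_real_derivative 1) (at t)"
      by (auto intro!: derivative_eq_intros)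
    from DERIV_chain'[OF this DERIV_pos_part_power2] show ?thesis
      by simp
  qed
  show ?thesis
    unfolding ramp_def [abs_def] tent_def
    by (rule derivative_eq_intros DERIV_pos_part_power2 * refl | simp)+
qed

lemma continuous_on_tent: "continuous_on S tent"
  unfolding tent_def [abs_def] by (intro continuous_intros)

lemma tent_nonneg: "0 \<le> tent t" and tent_eq_0: "t \<notin> {0..2} \<Longrightarrow> tent t = 0"
  by (auto simp: tent_def max_def)

lemma ramp_eq_0: "t \<le> 0 \<Longrightarrow> ramp t = 0"
  and ramp_eq_1: "2 \<le> t \<Longrightarrow> ramp t = 1"
  by (auto simp: ramp_def max_def power2_eq_square algebra_simps)

lemma ramp_mono: "s \<le> t \<Longrightarrow> ramp s \<le> ramp t"
  by (rule DERIV_nonneg_imp_nondecreasing) (use DERIV_ramp tent_nonneg in blast)+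

lemma ramp_bounds: "0 \<le> ramp t" "ramp t \<le> 1"
proof -
  have "ramp (min t 0) \<le> ramp t" "ramp t \<le> ramp (max t 2)"
    by (intro ramp_mono; simp)+
  then show "0 \<le> ramp t" "ramp t \<le> 1"
    by (simp_all add: ramp_eq_0 ramp_eq_1)
qed

text \<open>An approximate identity at \<open>a\<close>, supported in \<open>[a, a + 2h]\<close>.  The mass lies to the right of
  \<open>a\<close>, so the supports stay inside the open half-line.\<close>
definition bump :: "real \<Rightarrow> real \<Rightarrow> real \<Rightarrow> real" where
  "bump h a t = tent ((t - a) / h) / h"

lemma DERIV_scaled_ramp:
  assumes "h > 0"
  shows "((\<lambda>t. ramp ((t - a) / h)) has_real_derivative bump h a t) (at t)"
proof -
  have "((\<lambda>t. (t - a) / h) has_real_derivative 1 / h) (at t)"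
    using assms by (auto intro!: derivative_eq_intros)
  from DERIV_chain'[OF this DERIV_ramp] show ?thesis
    by (simp add: bump_def)
qed

lemma continuous_on_bump: "continuous_on S (bump h a)"
  unfolding bump_def [abs_def] divide_inverse
  by (intro continuous_intros continuous_on_compose2[OF continuous_on_tent[of UNIV]]) auto

lemma bump_nonneg: "h > 0 \<Longrightarrow> 0 \<le> bump h a t"
  by (simp add: bump_def tent_nonneg)

lemma bump_eq_0: "h > 0 \<Longrightarrow> t \<notin> {a..a + 2 * h} \<Longrightarrow> bump h a t = 0"
  by (auto simp: bump_def field_simps intro!: tent_eq_0)

lemma bump_has_integral:
  assumes "h > 0"
  shows "(bump h a has_integral 1) {a..a + 2 * h}"
proof -
  have "(bump h a has_integral ramp ((a + 2 * h - a) / h) - ramp ((a - a) / h)) {a..a + 2 * h}"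
    using assms
    by (intro fundamental_theorem_of_calculus)
       (auto simp flip: has_real_derivative_iff_has_vector_derivative
             intro: DERIV_scaled_ramp has_field_derivative_at_within)
  then show ?thesis
    using assms by (simp add: ramp_eq_0 ramp_eq_1)
qed

lemma integral_bump_tendsto:
  fixes u :: "real \<Rightarrow> 'a::euclidean_space"
  assumes u: "continuous_on {t0..} u" and a: "t0 < a"
    and h: "\<And>n. h n > 0" "h \<longlonglongrightarrow> 0"
  shows "(\<lambda>n. integral {t0..} (\<lambda>t. bump (h n) a t *\<^sub>R u t)) \<longlonglongrightarrow> u a"
    and "\<And>n. (\<lambda>t. bump (h n) a t *\<^sub>R u t) integrable_on {t0..}"
proof -
  let ?J = "\<lambda>n. {a..a + 2 * h n}"
  have int: "(\<lambda>t. bump (h n) a t *\<^sub>R u t) integrable_on ?J n" for n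
    using a by (intro integrable_continuous_real continuous_intros continuous_on_bump
        continuous_on_subset[OF u]) auto
  have hi: "((\<lambda>t. bump (h n) a t *\<^sub>R u t) has_integral
      integral (?J n) (\<lambda>t. bump (h n) a t *\<^sub>R u t)) {t0..}" for n
    using bump_eq_0[OF h(1)[of n]] a
    by (intro has_integral_on_superset[OF integrable_integral[OF int]]) auto
  then show "\<And>n. (\<lambda>t. bump (h n) a t *\<^sub>R u t) integrable_on {t0..}"
    by (auto simp: integrable_on_def)
  have "(\<lambda>n. integral (?J n) (\<lambda>t. bump (h n) a t *\<^sub>R u t)) \<longlonglongrightarrow> u a"
  proof (rule tendstoI)
    fix e :: real assume e: "e > 0"
    have "isCont u a"
      using u a continuous_on_interior[of "{t0..}" u a] by auto
    then obtain d where d: "d > 0" "\<And>t. dist t a < d \<Longrightarrow> dist (u t) (u a) < e / 2"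
      using e by (metis continuous_at_eps_delta half_gt_zero)
    have "\<forall>\<^sub>F n in sequentially. h n < d / 2"
      using order_tendstoD(2)[OF h(2), of "d/2"] d by auto
    then show "\<forall>\<^sub>F n in sequentially. dist (integral (?J n) (\<lambda>t. bump (h n) a t *\<^sub>R u t)) (u a) < e"
    proof eventually_elim
      case (elim n)
      have 1: "((\<lambda>t. bump (h n) a t *\<^sub>R u a) has_integral 1 *\<^sub>R u a) (?J n)"
        by (intro has_integral_scaleR_left bump_has_integral h)
      have 2: "((\<lambda>t. bump (h n) a t * (e / 2)) has_integral 1 * (e / 2)) (?J n)"
        by (intro has_integral_mult_left bump_has_integral h)
      have 3: "((\<lambda>t. bump (h n) a t *\<^sub>R u t - bump (h n) a t *\<^sub>R u a) has_integral
          integral (?J n) (\<lambda>t. bump (h n) a t *\<^sub>R u t) - 1 *\<^sub>R u a) (?J n)"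
        by (intro has_integral_diff 1 integrable_integral int)
      have "norm (integral (?J n) (\<lambda>t. bump (h n) a t *\<^sub>R u t - bump (h n) a t *\<^sub>R u a))
          \<le> integral (?J n) (\<lambda>t. bump (h n) a t * (e / 2))"
      proof (rule integral_norm_bound_integral)
        fix t assume t: "t \<in> ?J n"
        have "dist t a < d" using t elim by (auto simp: dist_real_def)
        then have "norm (u t - u a) \<le> e / 2" using d(2) by (auto simp: dist_norm intro: less_imp_le)
        from mult_left_mono[OF this bump_nonneg[OF h(1)[of n], of a t]]
        show "norm (bump (h n) a t *\<^sub>R u t - bump (h n) a t *\<^sub>R u a) \<le> bump (h n) a t * (e / 2)"
          using bump_nonneg[OF h(1)[of n], of a t]
          by (simp flip: scaleR_diff_right)
      qed (use 2 3 in \<open>auto simp: integrable_on_def\<close>)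
      then show ?case
        using e integral_unique[OF 2] integral_unique[OF 3] by (simp add: dist_norm)
    qed
  qed
  then show "(\<lambda>n. integral {t0..} (\<lambda>t. bump (h n) a t *\<^sub>R u t)) \<longlonglongrightarrow> u a"
    using integral_unique[OF hi] by simp
qed

lemma absolutely_integrable_bilinear_continuous:
  fixes B :: "'a::euclidean_space \<Rightarrow> 'b::euclidean_space \<Rightarrow> 'c::euclidean_space"
  assumes "bounded_bilinear B" "continuous_on {a..b} F" "g absolutely_integrable_on {a..b::real}"
  shows "(\<lambda>t. B (F t) (g t)) absolutely_integrable_on {a..b}"
  using assms
  by (intro absolutely_integrable_bounded_measurable_product[where h = B])
     (auto intro!: continuous_imp_measurable_on_sets_lebesgue compact_imp_bounded compact_continuous_image
       simp: bilinear_conv_bounded_bilinear)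

text \<open>The identity that defines the weak derivative is tested with \<open>C\<^sup>1\<close> approximations of the
  indicator function of \<open>(a, b]\<close>, namely differences of two shifted and scaled ramps.  Their
  derivatives are approximate identities at \<open>a\<close> and at \<open>b\<close>.\<close>
lemma weak_derivative_has_integral:
  fixes u v :: "real \<Rightarrow> 'a::euclidean_space"
  assumes u: "continuous_on {t0..} u" and v: "L1_loc t0 v" and w: "weak_derivative t0 u v"
    and ab: "t0 < a" "a \<le> b"
  shows "(v has_integral u b - u a) {a..b}"
proof -
  define h where "h n = inverse (real (Suc n))" for n
  have h: "h n > 0" "h \<longlonglongrightarrow> 0" "h n \<le> 1" for n
    using LIMSEQ_inverse_real_of_nat by (auto simp: h_def[abs_def] divide_simps)
  define \<phi> where "\<phi> n t = ramp ((t - a) / h n) - ramp ((t - b) / h n)" for n t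
  have D: "(\<phi> n has_real_derivative bump (h n) a t - bump (h n) b t) (at t)" for n t
    unfolding \<phi>_def [abs_def] by (intro DERIV_diff DERIV_scaled_ramp h)
  have zero: "\<phi> n t = 0" if "t \<notin> {a..b + 2}" for n t
  proof -
    have "t < a \<or> t > b + 2" using that by auto
    then show ?thesis
    proof
      assume "t < a"
      then show ?thesis
        using h(1)[of n] ab by (simp add: \<phi>_def ramp_eq_0 divide_nonpos_pos)
    next
      assume "t > b + 2"
      then have "t - b \<ge> 2 * h n" "t - a \<ge> 2 * h n" using h(3)[of n] ab by linarith+
      then show ?thesis
        using h(1)[of n] by (simp add: \<phi>_def ramp_eq_1 pos_le_divide_eq)
    qed
  qed
  have test: "test_function t0 (\<phi> n)" for n
    unfolding test_function_def C1_differentiable_on_def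
  proof (intro conjI exI)
    show "\<forall>t\<in>UNIV. (\<phi> n has_vector_derivative bump (h n) a t - bump (h n) b t) (at t)"
      using D by (simp flip: has_real_derivative_iff_has_vector_derivative)
    show "continuous_on UNIV (\<lambda>t. bump (h n) a t - bump (h n) b t)"
      by (intro continuous_intros continuous_on_bump)
    show "\<forall>t. t \<notin> {a..b + 2} \<longrightarrow> \<phi> n t = 0"
      using zero by blast
  qed (fact ab)
  have deriv: "deriv (\<phi> n) t = bump (h n) a t - bump (h n) b t" for n t
    by (rule DERIV_imp_deriv[OF D])
  have eq: "integral {t0..} (\<lambda>t. bump (h n) a t *\<^sub>R u t) - integral {t0..} (\<lambda>t. bump (h n) b t *\<^sub>R u t)
      = - integral {a..b + 2} (\<lambda>t. \<phi> n t *\<^sub>R v t)" for n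
  proof -
    have "integral {t0..} (\<lambda>t. deriv (\<phi> n) t *\<^sub>R u t) = - integral {t0..} (\<lambda>t. \<phi> n t *\<^sub>R v t)"
      using w test unfolding weak_derivative_def by blast
    moreover have "integral {t0..} (\<lambda>t. deriv (\<phi> n) t *\<^sub>R u t) =
        integral {t0..} (\<lambda>t. bump (h n) a t *\<^sub>R u t) - integral {t0..} (\<lambda>t. bump (h n) b t *\<^sub>R u t)"
      using integral_bump_tendsto(2)[OF u _ h(1,2)] ab
      by (simp add: deriv scaleR_left_diff_distrib integral_diff)
    moreover have "integral {t0..} (\<lambda>t. \<phi> n t *\<^sub>R v t) = integral {a..b + 2} (\<lambda>t. \<phi> n t *\<^sub>R v t)"
    proof -
      have "integral {t0..} (\<lambda>t. \<phi> n t *\<^sub>R v t)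
          = integral {t0..} (\<lambda>t. if t \<in> {a..b + 2} then \<phi> n t *\<^sub>R v t else 0)"
        using zero by (intro integral_cong) auto
      also have "\<dots> = integral ({a..b + 2} \<inter> {t0..}) (\<lambda>t. \<phi> n t *\<^sub>R v t)"
        by (rule integral_restrict_Int)
      also have "{a..b + 2} \<inter> {t0..} = {a..b + 2}"
        using ab by auto
      finally show ?thesis .
    qed
    ultimately show ?thesis by simp
  qed
  have vi: "v absolutely_integrable_on {a..b + 2}"
    using v ab unfolding L1_loc_def
    by (auto intro: set_integrable_subset[of _ "{t0..b + 2}"])
  have lim: "(\<lambda>n. \<phi> n t *\<^sub>R v t) \<longlonglongrightarrow> indicator {a<..b} t *\<^sub>R v t" for t
  proof -
    have one: "\<forall>\<^sub>F n in sequentially. ramp ((t - c) / h n) = 1" if "c < t" for c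
    proof -
      have "\<forall>\<^sub>F n in sequentially. h n < (t - c) / 2"
        using order_tendstoD(2)[OF h(2), of "(t - c) / 2"] that by auto
      then show ?thesis
      proof eventually_elim
        case (elim n)
        then have "2 \<le> (t - c) / h n" using h(1)[of n] by (simp add: pos_le_divide_eq)
        then show ?case by (rule ramp_eq_1)
      qed
    qed
    have null: "ramp ((t - c) / h n) = 0" if "t \<le> c" for c n
      using h(1)[of n] that by (intro ramp_eq_0) (simp add: divide_nonpos_pos)
    have "\<forall>\<^sub>F n in sequentially. \<phi> n t = indicator {a<..b} t"
    proof (cases "b < t")
      case True
      have "\<forall>\<^sub>F n in sequentially. ramp ((t - a) / h n) = 1 \<and> ramp ((t - b) / h n) = 1"
        using one[of a] one[of b] True ab by (auto intro: eventually_conj)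
      then show ?thesis by eventually_elim (use True in \<open>auto simp: \<phi>_def\<close>)
    next
      case False
      show ?thesis
      proof (cases "a < t")
        case True
        from one[OF this] show ?thesis
          by eventually_elim (use True False null[of b] in \<open>auto simp: \<phi>_def\<close>)
      qed (use False null ab in \<open>auto simp: \<phi>_def\<close>)
    qed
    then show ?thesis
      by (intro tendsto_intros) (rule tendsto_eventually)
  qed
  have conv: "(\<lambda>n. integral {a..b + 2} (\<lambda>t. \<phi> n t *\<^sub>R v t)) \<longlonglongrightarrow>
      integral {a..b + 2} (\<lambda>t. indicator {a<..b} t *\<^sub>R v t)"
  proof (rule dominated_convergence(2)[where h = "\<lambda>t. norm (v t)"])
    show "(\<lambda>t. \<phi> n t *\<^sub>R v t) integrable_on {a..b + 2}" for n
    proof -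
      have c: "continuous_on {a..b + 2} (\<phi> n)"
        by (rule DERIV_continuous_on[OF has_field_derivative_at_within[OF D]])
      from absolutely_integrable_bilinear_continuous[OF bounded_bilinear_scaleR this vi]
      show ?thesis by (simp add: absolutely_integrable_on_def)
    qed
    show "norm (\<phi> n t *\<^sub>R v t) \<le> norm (v t)" for n t
    proof -
      have "\<bar>\<phi> n t\<bar> \<le> 1"
        using ramp_bounds[of "(t - a) / h n"] ramp_bounds[of "(t - b) / h n"] by (auto simp: \<phi>_def)
      then show ?thesis by (simp add: mult_left_le_one_le)
    qed
  qed (use vi lim in \<open>auto simp: absolutely_integrable_on_def\<close>)
  have "integral {a..b + 2} (\<lambda>t. indicator {a<..b} t *\<^sub>R v t) = integral {a..b} v"
  proof -
    have "integral {a..b + 2} (\<lambda>t. indicator {a<..b} t *\<^sub>R v t)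
        = integral {a..b + 2} (\<lambda>t. if t \<in> {a<..b} then v t else 0)"
      by (intro integral_cong) auto
    also have "\<dots> = integral {a<..b} v"
      by (subst integral_restrict_Int) (auto intro!: arg_cong2[where f = integral])
    also have "\<dots> = integral {a..b} v"
    proof (rule integral_spike_set)
      have "{x \<in> {a<..b} - {a..b}. v x \<noteq> 0} = {}" by auto
      then show "negligible {x \<in> {a<..b} - {a..b}. v x \<noteq> 0}" by (metis negligible_empty)
      show "negligible {x \<in> {a..b} - {a<..b}. v x \<noteq> 0}"
        by (rule negligible_subset[of "{a}"]) auto
    qed
    finally show ?thesis .
  qed
  moreover have "(\<lambda>n. integral {t0..} (\<lambda>t. bump (h n) a t *\<^sub>R u t)
      - integral {t0..} (\<lambda>t. bump (h n) b t *\<^sub>R u t)) \<longlonglongrightarrow> u a - u b"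
    using ab by (intro tendsto_intros integral_bump_tendsto[OF u] h) auto
  ultimately have "u a - u b = - integral {a..b} v"
    using LIMSEQ_unique tendsto_minus[OF conv] unfolding eq by auto
  moreover have "v integrable_on {a..b}"
    using vi set_lebesgue_integral_eq_integral(1) integrable_subinterval_real[of v a "b + 2" a b] by auto
  ultimately show ?thesis
    by (metis integrable_integral minus_diff_eq minus_minus)
qed

section \<open>Absolutely continuous functions\<close>

text \<open>\<open>F\<close> is absolutely continuous on \<open>[a, b]\<close> and \<open>f\<close> is its derivative almost everywhere.  This
  is encoded through the fundamental theorem of calculus, which is the only property needed.\<close>
definition ac_deriv_on ::
  "real \<Rightarrow> real \<Rightarrow> (real \<Rightarrow> 'a::euclidean_space) \<Rightarrow> (real \<Rightarrow> 'a) \<Rightarrow> bool" where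
  "ac_deriv_on a b F f \<longleftrightarrow> f absolutely_integrable_on {a..b} \<and>
     (\<forall>s t. a \<le> s \<and> s \<le> t \<and> t \<le> b \<longrightarrow> (f has_integral F t - F s) {s..t})"

lemma ac_deriv_onD:
  "ac_deriv_on a b F f \<Longrightarrow> f absolutely_integrable_on {a..b}"
  "ac_deriv_on a b F f \<Longrightarrow> a \<le> s \<Longrightarrow> s \<le> t \<Longrightarrow> t \<le> b \<Longrightarrow> (f has_integral F t - F s) {s..t}"
  by (auto simp: ac_deriv_on_def)

lemma ac_deriv_on_imp_continuous_on:
  assumes "ac_deriv_on a b F f"
  shows "continuous_on {a..b} F"
proof -
  have "continuous_on {a..b} (\<lambda>t. F a + integral {a..t} f)"
    using ac_deriv_onD(1)[OF assms]
    by (intro continuous_intros indefinite_integral_continuous_1) (simp add: absolutely_integrable_on_def)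
  moreover have "F t = F a + integral {a..t} f" if "t \<in> {a..b}" for t
    using integral_unique[OF ac_deriv_onD(2)[OF assms, of a t]] that by simp
  ultimately show ?thesis
    using continuous_on_eq by (metis (mono_tags, lifting))
qed

lemma ac_deriv_on_vector_derivative:
  assumes "\<And>t. t \<in> {a..b} \<Longrightarrow> (F has_vector_derivative f t) (at t within {a..b})"
    and "continuous_on {a..b} f"
  shows "ac_deriv_on a b F f"
  unfolding ac_deriv_on_def
proof (intro conjI allI impI)
  fix s t assume "a \<le> s \<and> s \<le> t \<and> t \<le> b"
  then show "(f has_integral F t - F s) {s..t}"
    using assms(1) by (intro fundamental_theorem_of_calculus)
      (auto intro: has_vector_derivative_within_subset[where S = "{a..b}"])
qed (use assms in \<open>auto intro: absolutely_integrable_continuous_real\<close>)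

lemma ac_deriv_on_add:
  assumes "ac_deriv_on a b F f" "ac_deriv_on a b G g"
  shows "ac_deriv_on a b (\<lambda>t. F t + G t) (\<lambda>t. f t + g t)"
  unfolding ac_deriv_on_def
proof (intro conjI allI impI)
  fix s t assume st: "a \<le> s \<and> s \<le> t \<and> t \<le> b"
  show "((\<lambda>t. f t + g t) has_integral F t + G t - (F s + G s)) {s..t}"
    using has_integral_add[OF assms[THEN ac_deriv_onD(2), of s t]] st by (simp add: algebra_simps)
qed (use assms in \<open>auto dest!: ac_deriv_onD(1)\<close>)

text \<open>The product rule for absolutely continuous functions.  On a short interval around any point,
  the increment of the product and the integral of the candidate derivative differ by at most
  \<open>\<eta> \<integral> (|f| + |g|)\<close>, because \<open>F\<close> and \<open>G\<close> oscillate little there.  This bound is additive in the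
  interval, so by a bisection argument it holds on every subinterval, for every \<open>\<eta> > 0\<close>.\<close>
lemma ac_deriv_on_bilinear:
  fixes F :: "real \<Rightarrow> 'a::euclidean_space" and G :: "real \<Rightarrow> 'b::euclidean_space"
    and B :: "'a \<Rightarrow> 'b \<Rightarrow> 'c::euclidean_space"
  assumes B: "bounded_bilinear B" and F: "ac_deriv_on a b F f" and G: "ac_deriv_on a b G g"
  shows "ac_deriv_on a b (\<lambda>t. B (F t) (G t)) (\<lambda>t. B (F t) (g t) + B (f t) (G t))"
proof -
  interpret bounded_bilinear B by fact
  define k where "k t = B (F t) (g t) + B (f t) (G t)" for t
  define r where "r t = norm (f t) + norm (g t)" for t
  obtain C where C: "C > 0" "\<And>x y. norm (B x y) \<le> norm x * norm y * C"
    using pos_bounded by blast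
  have cF: "continuous_on {a..b} F" and cG: "continuous_on {a..b} G"
    using F G ac_deriv_on_imp_continuous_on by auto
  have k: "k absolutely_integrable_on {a..b}"
    unfolding k_def [abs_def]
    using absolutely_integrable_bilinear_continuous[OF B cF ac_deriv_onD(1)[OF G]]
      absolutely_integrable_bilinear_continuous[OF flip cG ac_deriv_onD(1)[OF F]]
    by simp
  have r: "r integrable_on {a..b}"
    unfolding r_def [abs_def] using F G
    by (intro integrable_add) (auto dest!: ac_deriv_onD(1) simp: absolutely_integrable_on_def)
  have ki: "k integrable_on {s..t}" and ri: "r integrable_on {s..t}" if "a \<le> s" "t \<le> b" for s t
    using that k r by (auto simp: absolutely_integrable_on_def intro: integrable_subinterval_real)
  \<comment> \<open>The bound that is additive in the interval, to be proved by bisection.\<close>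
  have est: "norm (B (F t) (G t) - B (F s) (G s) - integral {s..t} k) \<le> \<eta> * integral {s..t} r"
    if st: "a \<le> s" "s \<le> t" "t \<le> b" and \<eta>: "\<eta> > 0" for s t \<eta>
  proof -
    define P where "P p q \<longleftrightarrow> (a \<le> p \<longrightarrow> p \<le> q \<longrightarrow> q \<le> b \<longrightarrow>
      norm (B (F q) (G q) - B (F p) (G p) - integral {p..q} k) \<le> \<eta> * integral {p..q} r)" for p q
    have "P s t"
    proof (induction rule: Bolzano[OF \<open>s \<le> t\<close>])
      case (1 p q w)
      show ?case
        unfolding P_def
      proof (intro impI)
        assume *: "a \<le> p" "p \<le> w" "w \<le> b"
        have "integral {p..q} k + integral {q..w} k = integral {p..w} k"
          by (rule Henstock_Kurzweil_Integration.integral_combine[OF 1(3,4) ki[OF *(1,3)]])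
        moreover have "integral {p..q} r + integral {q..w} r = integral {p..w} r"
          by (rule Henstock_Kurzweil_Integration.integral_combine[OF 1(3,4) ri[OF *(1,3)]])
        moreover have "norm (B (F q) (G q) - B (F p) (G p) - integral {p..q} k) \<le> \<eta> * integral {p..q} r"
          "norm (B (F w) (G w) - B (F q) (G q) - integral {q..w} k) \<le> \<eta> * integral {q..w} r"
          using * 1 by (auto simp: P_def)
        moreover have "B (F w) (G w) - B (F p) (G p) - (integral {p..q} k + integral {q..w} k)
            = (B (F q) (G q) - B (F p) (G p) - integral {p..q} k)
              + (B (F w) (G w) - B (F q) (G q) - integral {q..w} k)"
          by simp
        ultimately show "norm (B (F w) (G w) - B (F p) (G p) - integral {p..w} k) \<le> \<eta> * integral {p..w} r"
          by (metis (no_types, lifting) add_mono distrib_left norm_triangle_le)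
      qed
    next
      case (2 z)
      then have z: "z \<in> {a..b}" using st by auto
      \<comment> \<open>The admissible oscillation of \<open>F\<close> and \<open>G\<close> around \<open>z\<close>; the factor 2 accounts for passing
        through the value at \<open>z\<close>.\<close>
      define \<omega> where "\<omega> = \<eta> / C / 2"
      have \<omega>: "\<omega> > 0" "2 * \<omega> * C = \<eta>" using \<eta> C by (auto simp: \<omega>_def)
      obtain d1 where d1: "d1 > 0" "\<And>p. p \<in> {a..b} \<Longrightarrow> dist p z < d1 \<Longrightarrow> dist (F p) (F z) < \<omega>"
        using cF z \<omega> unfolding continuous_on_iff by metis
      obtain d2 where d2: "d2 > 0" "\<And>p. p \<in> {a..b} \<Longrightarrow> dist p z < d2 \<Longrightarrow> dist (G p) (G z) < \<omega>"
        using cG z \<omega> unfolding continuous_on_iff by metis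
      show ?case
      proof (intro exI[of _ "min d1 d2"] conjI allI impI)
        fix p q assume pq: "p \<le> z \<and> z \<le> q \<and> q - p < min d1 d2"
        show "P p q"
          unfolding P_def
        proof (intro impI)
          assume *: "a \<le> p" "p \<le> q" "q \<le> b"
          have close: "norm (F q - F \<tau>) \<le> 2 * \<omega>" "norm (G p - G \<tau>) \<le> 2 * \<omega>" if "\<tau> \<in> {p..q}" for \<tau>
          proof -
            have "dist (F q) (F z) < \<omega>" "dist (F \<tau>) (F z) < \<omega>" "dist (G p) (G z) < \<omega>" "dist (G \<tau>) (G z) < \<omega>"
              using that pq * by (auto intro!: d1 d2 simp: dist_real_def)
            then show "norm (F q - F \<tau>) \<le> 2 * \<omega>" "norm (G p - G \<tau>) \<le> 2 * \<omega>"
              using dist_triangle2[of "F q" "F \<tau>" "F z"] dist_triangle2[of "G p" "G \<tau>" "G z"]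
              by (auto simp: dist_norm)
          qed
          \<comment> \<open>With \<open>F\<close> fixed at \<open>q\<close> and \<open>G\<close> at \<open>p\<close>, the increment of the product is exactly an integral.\<close>
          have "((\<lambda>\<tau>. B (F q) (g \<tau>) + B (f \<tau>) (G p)) has_integral
              B (F q) (G q - G p) + B (F q - F p) (G p)) {p..q}"
            using has_integral_linear[OF ac_deriv_onD(2)[OF G *] bounded_linear_right[of "F q"]]
              has_integral_linear[OF ac_deriv_onD(2)[OF F *] bounded_linear_left[of "G p"]]
            by (intro has_integral_add) (auto simp: o_def)
          from has_integral_diff[OF this integrable_integral[OF ki[OF *(1,3)]]]
          have 1: "((\<lambda>\<tau>. B (F q) (g \<tau>) + B (f \<tau>) (G p) - k \<tau>) has_integral
              B (F q) (G q) - B (F p) (G p) - integral {p..q} k) {p..q}"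
            by (simp add: diff_left diff_right)
          have "norm (integral {p..q} (\<lambda>\<tau>. B (F q) (g \<tau>) + B (f \<tau>) (G p) - k \<tau>))
              \<le> integral {p..q} (\<lambda>\<tau>. \<eta> * r \<tau>)"
          proof (rule integral_norm_bound_integral)
            fix \<tau> assume \<tau>: "\<tau> \<in> {p..q}"
            have "norm (B (F q - F \<tau>) (g \<tau>)) \<le> 2 * \<omega> * norm (g \<tau>) * C"
              using close(1)[OF \<tau>] C(1)
              by (intro order_trans[OF C(2)] mult_right_mono) auto
            moreover have "norm (B (f \<tau>) (G p - G \<tau>)) \<le> norm (f \<tau>) * (2 * \<omega>) * C"
              using close(2)[OF \<tau>] C(1)
              by (intro order_trans[OF C(2)] mult_right_mono mult_left_mono) auto
            moreover have "B (F q) (g \<tau>) + B (f \<tau>) (G p) - k \<tau> = B (F q - F \<tau>) (g \<tau>) + B (f \<tau>) (G p - G \<tau>)"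
              by (simp add: k_def diff_left diff_right)
            ultimately have "norm (B (F q) (g \<tau>) + B (f \<tau>) (G p) - k \<tau>)
                \<le> 2 * \<omega> * norm (g \<tau>) * C + norm (f \<tau>) * (2 * \<omega>) * C"
              using norm_triangle_ineq[of "B (F q - F \<tau>) (g \<tau>)" "B (f \<tau>) (G p - G \<tau>)"] by simp
            also have "\<dots> = \<eta> * r \<tau>"
              unfolding r_def \<omega>(2)[symmetric] by (simp add: algebra_simps)
            finally show "norm (B (F q) (g \<tau>) + B (f \<tau>) (G p) - k \<tau>) \<le> \<eta> * r \<tau>" .
          next
            show "(\<lambda>\<tau>. \<eta> * r \<tau>) integrable_on {p..q}"
              by (intro integrable_on_mult_right ri *)
          qed (use 1 in \<open>auto simp: integrable_on_def\<close>)
          then show "norm (B (F q) (G q) - B (F p) (G p) - integral {p..q} k) \<le> \<eta> * integral {p..q} r"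
            using integral_unique[OF 1] by simp
        qed
      qed (use d1 d2 in auto)
    qed
    then show ?thesis using st by (simp add: P_def)
  qed
  have "(k has_integral B (F t) (G t) - B (F s) (G s)) {s..t}" if st: "a \<le> s" "s \<le> t" "t \<le> b" for s t
  proof -
    let ?d = "B (F t) (G t) - B (F s) (G s) - integral {s..t} k"
    have "norm ?d \<le> 0 + e" if e: "e > 0" for e
    proof -
      have nn: "integral {s..t} r \<ge> 0"
        using st by (intro integral_nonneg ri) (auto simp: r_def)
      have "norm ?d \<le> e / (integral {s..t} r + 1) * integral {s..t} r"
        using e nn by (intro est st) auto
      also have "\<dots> \<le> e"
        using e nn by (simp add: field_simps)
      finally show ?thesis by simp
    qed
    then have "norm ?d \<le> 0" by (rule field_le_epsilon)
    then show ?thesis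
      using integrable_integral[OF ki[OF st(1,3)]] by simp
  qed
  then show ?thesis
    using k unfolding ac_deriv_on_def k_def by auto
qed

section \<open>Trajectories and integral estimates\<close>

lemma C1_fromD:
  assumes "C1_from t0 u"
  shows "t0 < t \<Longrightarrow> (u has_real_derivative deriv_from t0 u t) (at t)"
    and "continuous_on {t0..} u"
proof -
  have D: "u differentiable (at t within {t0..})" if "t0 \<le> t" for t
    using assms that by (auto simp: C1_from_def)
  show "continuous_on {t0..} u"
    using D differentiable_imp_continuous_within by (auto simp: continuous_on_eq_continuous_within)
  assume t: "t0 < t"
  then have "at t within {t0..} = at t"
    by (intro at_within_interior) auto
  then show "(u has_real_derivative deriv_from t0 u t) (at t)"
    using D[of t] t vector_derivative_works[of u "at t within {t0..}"]
    by (simp add: deriv_from_def has_real_derivative_iff_has_vector_derivative)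
qed

lemma W21_loc_has_vector_derivative:
  assumes W: "W21_loc t0 u v w" and t: "t0 < t"
  shows "(u has_vector_derivative v t) (at t)"
proof -
  define a b where "a = (t0 + t) / 2" and "b = t + 1"
  have ab: "t0 < a" "a < t" "t < b"
    using t by (auto simp: a_def b_def)
  have c: "continuous_on {a..b} v"
    by (rule continuous_on_subset[of "{t0..}"]) (use W ab in \<open>auto simp: W21_loc_def\<close>)
  have 1: "((\<lambda>s. u a + integral {a..s} v) has_vector_derivative 0 + v t) (at t within {a..b})"
    using ab by (intro has_vector_derivative_add has_vector_derivative_const
        integral_has_vector_derivative c) auto
  have 2: "u s = u a + integral {a..s} v" if "s \<in> {a..b}" for s
    using integral_unique[OF weak_derivative_has_integral[of t0 u v a s]] W ab that
    by (auto simp: W21_loc_def)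
  have "(u has_vector_derivative 0 + v t) (at t within {a..b})"
    by (rule has_vector_derivative_transform[OF _ 2 1]) (use ab in auto)
  then show ?thesis
    using ab by (simp add: at_within_Icc_at)
qed

lemma W21_loc_ac_deriv_on:
  assumes W: "W21_loc t0 u v w" and a: "t0 < a"
  shows "ac_deriv_on a b v w"
  unfolding ac_deriv_on_def
proof (intro conjI allI impI)
  show "w absolutely_integrable_on {a..b}"
  proof (cases "t0 \<le> b")
    case True
    then have "w absolutely_integrable_on {t0..b}"
      using W by (simp add: W21_loc_def L1_loc_def)
    then show ?thesis
      by (rule set_integrable_subset) (use a in auto)
  qed (use a in auto)
  show "(w has_integral v t - v s) {s..t}" if "a \<le> s \<and> s \<le> t \<and> t \<le> b" for s t
    using W a that by (intro weak_derivative_has_integral[of t0]) (auto simp: W21_loc_def)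
qed

text \<open>The quadratic part of the energy is only absolutely continuous, since it contains the
  velocity; its derivative involves the second weak derivative.\<close>
lemma W21_loc_half_norm_has_integral:
  fixes u v w :: "real \<Rightarrow> 'a::euclidean_space" and c :: "'a" and \<theta> :: real
  assumes W: "W21_loc t0 u v w" and ab: "t0 < a" "a \<le> b"
  defines "p \<equiv> \<lambda>t. u t - c + (\<theta> * t) *\<^sub>R v t"
  shows "((\<lambda>t. p t \<bullet> ((1 + \<theta>) *\<^sub>R v t + (\<theta> * t) *\<^sub>R w t)) has_integral
    (p b \<bullet> p b) / 2 - (p a \<bullet> p a) / 2) {a..b}"
proof -
  have u: "ac_deriv_on a b (\<lambda>t. u t - c) v"
  proof (rule ac_deriv_on_vector_derivative)
    show "((\<lambda>t. u t - c) has_vector_derivative v t) (at t within {a..b})" if "t \<in> {a..b}" for t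
      using has_vector_derivative_diff[OF W21_loc_has_vector_derivative[OF W, of t]
          has_vector_derivative_const[of c]] that ab
      by (auto intro: has_vector_derivative_at_within)
    show "continuous_on {a..b} v"
      by (rule continuous_on_subset[of "{t0..}"]) (use W ab in \<open>auto simp: W21_loc_def\<close>)
  qed
  have "ac_deriv_on a b (\<lambda>t. \<theta> * t) (\<lambda>t. \<theta>)"
    by (rule ac_deriv_on_vector_derivative)
       (auto intro!: derivative_eq_intros simp flip: has_real_derivative_iff_has_vector_derivative)
  from ac_deriv_on_add[OF u ac_deriv_on_bilinear[OF bounded_bilinear_scaleR this W21_loc_ac_deriv_on[OF W ab(1)]]]
  have "ac_deriv_on a b p (\<lambda>t. v t + ((\<theta> * t) *\<^sub>R w t + \<theta> *\<^sub>R v t))"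
    unfolding p_def .
  moreover have "v t + ((\<theta> * t) *\<^sub>R w t + \<theta> *\<^sub>R v t) = (1 + \<theta>) *\<^sub>R v t + (\<theta> * t) *\<^sub>R w t" for t
    by (simp add: scaleR_left_distrib)
  ultimately have "ac_deriv_on a b p (\<lambda>t. (1 + \<theta>) *\<^sub>R v t + (\<theta> * t) *\<^sub>R w t)" (is "ac_deriv_on a b p ?p'")
    by simp
  from ac_deriv_onD(2)[OF ac_deriv_on_bilinear[OF bounded_bilinear_inner this this], of a b] ab(2)
  have "((\<lambda>t. p t \<bullet> ?p' t + ?p' t \<bullet> p t) has_integral p b \<bullet> p b - p a \<bullet> p a) {a..b}"
    by blast
  from has_integral_divide[OF this, of 2]
  have "((\<lambda>t. (p t \<bullet> ?p' t + ?p' t \<bullet> p t) / 2) has_integral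
      (p b \<bullet> p b) / 2 - (p a \<bullet> p a) / 2) {a..b}"
    unfolding diff_divide_distrib .
  moreover have "(p t \<bullet> ?p' t + ?p' t \<bullet> p t) / 2 = p t \<bullet> ?p' t" for t
    unfolding inner_commute[of "?p' t" "p t"] by (rule field_sum_of_halves[of "p t \<bullet> ?p' t", folded add_divide_distrib])
  ultimately show ?thesis
    by (simp only:)
qed

lemma AE_has_integral_le:
  fixes e h :: "'a::euclidean_space \<Rightarrow> real"
  assumes "(e has_integral I) S" "(h has_integral J) S"
    and "AE t in lebesgue. t \<in> S \<longrightarrow> e t \<le> h t"
  shows "I \<le> J"
proof -
  obtain N where N: "N \<in> null_sets lebesgue" "{t. \<not> (t \<in> S \<longrightarrow> e t \<le> h t)} \<subseteq> N"
    using assms(3) by (auto simp: eventually_ae_filter)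
  have "((\<lambda>t. if t \<in> N then h t else e t) has_integral I) S"
    by (rule has_integral_spike[OF _ _ assms(1)]) (use N in \<open>auto simp: negligible_iff_null_sets\<close>)
  then show ?thesis
    by (rule has_integral_le[OF _ assms(2)]) (use N in auto)
qed

lemma tail_integral_le:
  fixes h :: "real \<Rightarrow> real"
  assumes h: "h absolutely_integrable_on {t0..}" and nn: "\<And>t. t0 \<le> t \<Longrightarrow> 0 \<le> h t" and e: "e > 0"
  obtains T where "T > t0" "\<And>t. T \<le> t \<Longrightarrow> integral {T..t} h \<le> e"
proof -
  define H where "H t = integral {t0..t} h" for t
  have hi: "h integrable_on {t0..}"
    using h by (simp add: absolutely_integrable_on_def)
  have i: "h integrable_on {s..t}" if "t0 \<le> s" for s t
    by (rule integrable_on_subinterval[OF hi]) (use that in auto)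
  have H: "H s + integral {s..t} h = H t" if "t0 \<le> s" "s \<le> t" for s t
    unfolding H_def by (rule Henstock_Kurzweil_Integration.integral_combine[OF that i[OF order_refl]])
  have bdd: "bdd_above (H ` {t0<..})"
  proof (rule bdd_aboveI2)
    show "H t \<le> integral {t0..} h" for t
      unfolding H_def by (rule integral_subset_le[OF _ i[OF order_refl] hi]) (use nn in auto)
  qed
  have "\<exists>y\<in>H ` {t0<..}. Sup (H ` {t0<..}) - e < y"
    by (rule less_cSupD) (use e in auto)
  then obtain T where T: "T > t0" "Sup (H ` {t0<..}) - e < H T"
    by auto
  show ?thesis
  proof (rule that[OF T(1)])
    fix t assume t: "T \<le> t"
    have "H t \<le> Sup (H ` {t0<..})"
      using t T(1) by (intro cSup_upper bdd) auto
    then show "integral {T..t} h \<le> e"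
      using H[of T t] T t by simp
  qed
qed

section \<open>Convex functions with a Lipschitz gradient\<close>

lemma DERIV_GDERIV_compose:
  assumes "GDERIV f (p t) :> d" and "(p has_vector_derivative p') (at t)"
  shows "((\<lambda>s. f (p s)) has_real_derivative d \<bullet> p') (at t)"
proof -
  have "((\<lambda>s. f (p s)) has_derivative (\<lambda>h. (h *\<^sub>R p') \<bullet> d)) (at t)"
    using has_derivative_compose[OF assms(2)[unfolded has_vector_derivative_def] assms(1)[unfolded gderiv_def]] .
  then show ?thesis
    unfolding has_field_derivative_def
    by (rule has_derivative_eq_rhs) (auto simp: inner_commute)
qed

lemma has_vector_derivative_line: "((\<lambda>s. x + s *\<^sub>R d) has_vector_derivative d) (at s)"
  by (auto intro!: derivative_eq_intros)

lemma DERIV_inner_self: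
  assumes "(p has_vector_derivative p') (at t)"
  shows "((\<lambda>s. p s \<bullet> p s) has_real_derivative 2 * (p t \<bullet> p')) (at t)"
proof -
  have "((\<lambda>s. p s \<bullet> p s) has_vector_derivative p t \<bullet> p' + p' \<bullet> p t) (at t)"
    by (rule bounded_bilinear.has_vector_derivative[OF bounded_bilinear_inner assms assms])
  then show ?thesis
    by (simp add: has_real_derivative_iff_has_vector_derivative inner_commute[of p'])
qed

lemma DERIV_inner_const:
  assumes "(p has_vector_derivative p') (at t)" and "bounded_linear A"
  shows "((\<lambda>s. A (p s) \<bullet> c) has_real_derivative A p' \<bullet> c) (at t)"
  using bounded_linear.has_vector_derivative[OF
      bounded_linear_compose[OF bounded_linear_inner_left assms(2)] assms(1), of c]
  by (simp add: has_real_derivative_iff_has_vector_derivative)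

lemma convex_on_gradient_ineq:
  fixes f :: "'a::euclidean_space \<Rightarrow> real"
  assumes f: "convex_on UNIV f" and d: "f differentiable (at x)"
  shows "f z \<ge> f x + gradient f x \<bullet> (z - x)"
proof -
  define \<phi> where "\<phi> s = f (x + s *\<^sub>R (z - x))" for s
  have "convex_on UNIV \<phi>"
  proof (rule convex_onI)
    fix s a b :: real assume s: "0 < s" "s < 1"
    have "x + ((1 - s) *\<^sub>R a + s *\<^sub>R b) *\<^sub>R (z - x)
        = (1 - s) *\<^sub>R (x + a *\<^sub>R (z - x)) + s *\<^sub>R (x + b *\<^sub>R (z - x))"
      by (simp add: algebra_simps)
    then show "\<phi> ((1 - s) *\<^sub>R a + s *\<^sub>R b) \<le> (1 - s) * \<phi> a + s * \<phi> b"
      unfolding \<phi>_def using convex_onD[OF f, of s] s by simp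
  qed simp
  moreover have "(\<phi> has_real_derivative gradient f x \<bullet> (z - x)) (at 0)"
    unfolding \<phi>_def [abs_def] using GDERIV_gradient[OF d]
    by (intro DERIV_GDERIV_compose has_vector_derivative_line) simp
  ultimately have "\<phi> 1 - \<phi> 0 \<ge> gradient f x \<bullet> (z - x) * (1 - 0)"
    by (intro convex_on_imp_above_tangent[of UNIV]) auto
  then show ?thesis by (simp add: \<phi>_def)
qed

lemma descent_lemma:
  fixes f :: "'a::euclidean_space \<Rightarrow> real"
  assumes d: "\<And>x. f differentiable (at x)" and L: "L-lipschitz_on UNIV (gradient f)"
  shows "f (x + e) \<le> f x + gradient f x \<bullet> e + L / 2 * (norm e)\<^sup>2"
proof -
  \<comment> \<open>The Lipschitz bound says that \<open>\<psi>\<close> is nonincreasing for nonnegative arguments.\<close>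
  define \<psi> where "\<psi> s = f (x + s *\<^sub>R e) - s * (gradient f x \<bullet> e) - L / 2 * s\<^sup>2 * (norm e)\<^sup>2" for s
  have D: "(\<psi> has_real_derivative
      gradient f (x + s *\<^sub>R e) \<bullet> e - gradient f x \<bullet> e - L * s * (norm e)\<^sup>2) (at s)" for s
    unfolding \<psi>_def [abs_def]
    by (rule derivative_eq_intros DERIV_GDERIV_compose GDERIV_gradient d has_vector_derivative_line refl
        | simp)+
  have "\<psi> 1 \<le> \<psi> 0"
  proof (rule DERIV_nonpos_imp_nonincreasing[of 0 1 \<psi>])
    fix s :: real assume s: "0 \<le> s" "s \<le> 1"
    have "gradient f (x + s *\<^sub>R e) \<bullet> e - gradient f x \<bullet> e \<le> norm (gradient f (x + s *\<^sub>R e) - gradient f x) * norm e"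
      using norm_cauchy_schwarz[of "gradient f (x + s *\<^sub>R e) - gradient f x" e] by (simp add: inner_diff_left)
    also have "\<dots> \<le> (L * (s * norm e)) * norm e"
      using lipschitz_onD[OF L, of "x + s *\<^sub>R e" x] s
      by (intro mult_right_mono) (auto simp: dist_norm)
    also have "\<dots> = L * s * (norm e)\<^sup>2"
      by (simp add: power2_eq_square)
    finally show "\<exists>y. (\<psi> has_real_derivative y) (at s) \<and> y \<le> 0"
      using D[of s] by auto
  qed simp
  then show ?thesis by (simp add: \<psi>_def)
qed

text \<open>At a minimiser \<open>zs\<close> of \<open>f + \<langle>c, -\<rangle>\<close> the Lipschitz bound controls the change of the gradient
  by the gap in value.  A gradient step of length \<open>1 / L\<close> from \<open>x\<close> lowers the value by at least
  \<open>|\<nabla>f(x) + c|\<^sup>2 / (2 L)\<close>, and the value cannot fall below the minimum; in particular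
  \<open>\<nabla>f(zs) = -c\<close>.\<close>
lemma norm_gradient_le_gap:
  fixes f :: "'a::euclidean_space \<Rightarrow> real"
  assumes d: "\<And>x. f differentiable (at x)" and L: "L-lipschitz_on UNIV (gradient f)" "L > 0"
    and min: "\<And>z. f zs + c \<bullet> zs \<le> f z + c \<bullet> z"
  shows "(norm (gradient f x - gradient f zs))\<^sup>2 \<le> 2 * L * (f x + c \<bullet> x - (f zs + c \<bullet> zs))"
proof -
  have gap: "(norm (gradient f x + c))\<^sup>2 \<le> 2 * L * (f x + c \<bullet> x - (f zs + c \<bullet> zs))" for x
  proof -
    define G where "G = gradient f x + c"
    define e where "e = - (1 / L) *\<^sub>R G"
    have "f zs + c \<bullet> zs \<le> f (x + e) + c \<bullet> (x + e)"
      by (rule min)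
    also have "\<dots> \<le> f x + c \<bullet> x + G \<bullet> e + L / 2 * (norm e)\<^sup>2"
      using descent_lemma[OF d L(1), of x e] by (simp add: G_def inner_add_left inner_add_right)
    also have "\<dots> = f x + c \<bullet> x - (norm G)\<^sup>2 / (2 * L)"
      using L(2) by (simp add: e_def power2_norm_eq_inner field_simps power2_eq_square[of L])
    finally show ?thesis
      using L(2) by (simp add: G_def field_simps)
  qed
  have "gradient f zs = - c"
    using gap[of zs] by (simp add: eq_neg_iff_add_eq_0)
  then show ?thesis
    using gap[of x] by simp
qed

section \<open>The energy estimate\<close>

text \<open>A trajectory of the system together with a saddle point.  The Lipschitz bounds on the
  gradients are left out: the energy estimate does not depend on them.\<close>
locale gtrd =
  fixes f :: "real^'n \<Rightarrow> real" and g :: "real^'m \<Rightarrow> real" and K :: "real^'n^'m"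
    and \<alpha> \<beta> \<epsilon> :: "real \<Rightarrow> real" and \<theta> t0 :: real
    and x x' x'' :: "real \<Rightarrow> real^'n" and y y' y'' :: "real \<Rightarrow> real^'m"
    and xs :: "real^'n" and ys :: "real^'m"
  assumes f: "C1_convex f" and g: "C1_convex g"
    and t0_pos: "t0 > 0" and \<theta>_pos: "\<theta> > 0"
    and \<alpha>_C1: "C1_from t0 \<alpha>" and \<beta>_C1: "C1_from t0 \<beta>" and \<epsilon>_C1: "C1_from t0 \<epsilon>"
    and \<beta>_pos: "\<And>t. t \<ge> t0 \<Longrightarrow> \<beta> t > 0"
    and \<epsilon>_pos: "\<And>t. t \<ge> t0 \<Longrightarrow> \<epsilon> t > 0"
    and \<epsilon>_antimono: "antimono_on {t0..} \<epsilon>"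
    and damping: "\<And>t. t \<ge> t0 \<Longrightarrow> 1 + \<theta> - \<theta> * t * \<alpha> t \<le> 0"
    and scaling: "\<And>t. t \<ge> t0 \<Longrightarrow> (2 * \<theta> - 1) * \<beta> t + \<theta> * t * deriv_from t0 \<beta> t \<le> 0"
    and damping_rate: "\<And>t. t \<ge> t0 \<Longrightarrow> \<alpha> t + t * deriv_from t0 \<alpha> t \<le> t * \<beta> t * \<epsilon> t"
    and integrable: "(\<lambda>t. \<beta> t * \<epsilon> t / t) absolutely_integrable_on {t0..}"
    and trajectory: "GTRD_trajectory f g K \<alpha> \<beta> \<epsilon> \<theta> t0 x x' x'' y y' y''"
    and saddle: "(xs, ys) \<in> saddle_points f g K"
begin

lemma f_diff: "f differentiable (at z)" and g_diff: "g differentiable (at w)"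
  using f g by (auto simp: C1_convex_def)

lemma x_W21: "W21_loc t0 x x' x''" and y_W21: "W21_loc t0 y y' y''"
  using trajectory by (auto simp: GTRD_trajectory_def)

text \<open>The primal-dual gap along the trajectory, measured at the saddle point.\<close>
definition gap :: "real \<Rightarrow> real" where
  "gap t = lagrangian f g K (x t) ys - lagrangian f g K xs (y t)"

text \<open>The gap with the Tikhonov term.  Compared with the difference of the regularised
  Lagrangians, the constant \<open>\<epsilon>(t)/2 (|xs|\<^sup>2 + |ys|\<^sup>2)\<close> is not subtracted, so that the quantity is
  nonnegative.  The price is the source term \<open>energy_rate\<close> in the energy inequality.\<close>
definition reg_gap :: "real \<Rightarrow> real" where
  "reg_gap t = gap t + \<epsilon> t / 2 * (x t \<bullet> x t + y t \<bullet> y t)"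

text \<open>The part of the energy that does not involve the velocities, and is therefore differentiable
  at every \<open>t > t0\<close>.\<close>
definition smooth_energy :: "real \<Rightarrow> real" where
  "smooth_energy t = \<theta>\<^sup>2 * t\<^sup>2 * \<beta> t * reg_gap t +
     (\<theta> * t * \<alpha> t - \<theta> - 1) / 2 * ((x t - xs) \<bullet> (x t - xs) + (y t - ys) \<bullet> (y t - ys))"

text \<open>The vectors \<open>x - xs + \<theta> t x'\<close> and \<open>y - ys + \<theta> t y'\<close>, whose squared norms carry the velocities
  in the energy.\<close>
definition u :: "real \<Rightarrow> real^'n" where "u t = x t - xs + (\<theta> * t) *\<^sub>R x' t"
definition v :: "real \<Rightarrow> real^'m" where "v t = y t - ys + (\<theta> * t) *\<^sub>R y' t"

text \<open>The Lyapunov function; \<open>u\<close> and \<open>v\<close> make it only absolutely continuous.\<close>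
definition energy :: "real \<Rightarrow> real" where
  "energy t = smooth_energy t + (u t \<bullet> u t) / 2 + (v t \<bullet> v t) / 2"

text \<open>The constant \<open>C\<close> in the energy inequality \<open>energy' \<le> C t \<beta> \<epsilon>\<close>.\<close>
definition energy_rate :: real where
  "energy_rate = \<theta> / 2 * (xs \<bullet> xs + ys \<bullet> ys)"

lemma gap_nonneg: "gap t \<ge> 0"
  using saddle unfolding saddle_points_def gap_def
  by (smt (verit) case_prodD mem_Collect_eq)

lemma gap_eq: "gap t = f (x t) + (K *v x t) \<bullet> ys - g ys - (f xs + (K *v xs) \<bullet> y t - g (y t))"
  by (simp add: gap_def lagrangian_def)

lemma energy_rate_nonneg: "energy_rate \<ge> 0"
  using \<theta>_pos by (simp add: energy_rate_def)

text \<open>The time derivatives of \<open>gap\<close>, \<open>reg_gap\<close> and \<open>smooth_energy\<close>.\<close>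
definition gap_slope :: "real \<Rightarrow> real" where
  "gap_slope t = gradient f (x t) \<bullet> x' t + (K *v x' t) \<bullet> ys + gradient g (y t) \<bullet> y' t - (K *v xs) \<bullet> y' t"

definition reg_gap_slope :: "real \<Rightarrow> real" where
  "reg_gap_slope t = gap_slope t + deriv_from t0 \<epsilon> t / 2 * (x t \<bullet> x t + y t \<bullet> y t)
     + \<epsilon> t * (x t \<bullet> x' t + y t \<bullet> y' t)"

definition smooth_energy_slope :: "real \<Rightarrow> real" where
  "smooth_energy_slope t = \<theta>\<^sup>2 * (2 * t * \<beta> t + t\<^sup>2 * deriv_from t0 \<beta> t) * reg_gap t
     + \<theta>\<^sup>2 * t\<^sup>2 * \<beta> t * reg_gap_slope t
     + \<theta> * (\<alpha> t + t * deriv_from t0 \<alpha> t) / 2 * ((x t - xs) \<bullet> (x t - xs) + (y t - ys) \<bullet> (y t - ys))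
     + (\<theta> * t * \<alpha> t - \<theta> - 1) * ((x t - xs) \<bullet> x' t + (y t - ys) \<bullet> y' t)"

lemma x_deriv: "t0 < t \<Longrightarrow> (x has_vector_derivative x' t) (at t)"
  and y_deriv: "t0 < t \<Longrightarrow> (y has_vector_derivative y' t) (at t)"
  using W21_loc_has_vector_derivative[OF x_W21] W21_loc_has_vector_derivative[OF y_W21] by auto

lemma gap_deriv:
  assumes t: "t0 < t"
  shows "(gap has_real_derivative gap_slope t) (at t)"
proof -
  have 1: "((\<lambda>s. f (x s)) has_real_derivative gradient f (x t) \<bullet> x' t) (at t)"
    by (rule DERIV_GDERIV_compose[OF GDERIV_gradient[OF f_diff] x_deriv[OF t]])
  have 2: "((\<lambda>s. g (y s)) has_real_derivative gradient g (y t) \<bullet> y' t) (at t)"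
    by (rule DERIV_GDERIV_compose[OF GDERIV_gradient[OF g_diff] y_deriv[OF t]])
  have 3: "((\<lambda>s. (K *v x s) \<bullet> ys) has_real_derivative (K *v x' t) \<bullet> ys) (at t)"
    by (rule DERIV_inner_const[OF x_deriv[OF t] matrix_vector_mul_bounded_linear])
  have 4: "((\<lambda>s. (K *v xs) \<bullet> y s) has_real_derivative (K *v xs) \<bullet> y' t) (at t)"
    using DERIV_inner_const[OF y_deriv[OF t] bounded_linear_ident, of "K *v xs"]
    by (simp add: inner_commute)
  show ?thesis
    unfolding gap_eq [abs_def] gap_slope_def
    by (rule derivative_eq_intros 1 2 3 4 refl | simp)+
qed

lemma reg_gap_deriv:
  assumes t: "t0 < t"
  shows "(reg_gap has_real_derivative reg_gap_slope t) (at t)"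
  unfolding reg_gap_def [abs_def] reg_gap_slope_def
  by (rule derivative_eq_intros gap_deriv[OF t] C1_fromD(1)[OF \<epsilon>_C1 t]
      DERIV_inner_self[OF x_deriv[OF t]] DERIV_inner_self[OF y_deriv[OF t]] refl
      | simp add: algebra_simps)+

lemma smooth_energy_deriv:
  assumes t: "t0 < t"
  shows "(smooth_energy has_real_derivative smooth_energy_slope t) (at t)"
proof -
  have 1: "((\<lambda>s. x s - xs) has_vector_derivative x' t) (at t)"
    using has_vector_derivative_diff[OF x_deriv[OF t] has_vector_derivative_const[of xs]] by simp
  have 2: "((\<lambda>s. y s - ys) has_vector_derivative y' t) (at t)"
    using has_vector_derivative_diff[OF y_deriv[OF t] has_vector_derivative_const[of ys]] by simp
  have 3: "((\<lambda>s. \<theta>\<^sup>2 * s\<^sup>2 * \<beta> s) has_real_derivative \<theta>\<^sup>2 * (2 * t * \<beta> t + t\<^sup>2 * deriv_from t0 \<beta> t)) (at t)"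
    by (rule derivative_eq_intros C1_fromD(1)[OF \<beta>_C1 t] refl | simp add: algebra_simps)+
  have 4: "((\<lambda>s. (\<theta> * s * \<alpha> s - \<theta> - 1) / 2) has_real_derivative
      \<theta> * (\<alpha> t + t * deriv_from t0 \<alpha> t) / 2) (at t)"
    by (rule derivative_eq_intros C1_fromD(1)[OF \<alpha>_C1 t] refl | simp add: algebra_simps)+
  show ?thesis
    unfolding smooth_energy_def [abs_def]
    by (rule DERIV_cong[OF DERIV_add[OF DERIV_mult[OF 3 reg_gap_deriv[OF t]]
          DERIV_mult[OF 4 DERIV_add[OF DERIV_inner_self[OF 1] DERIV_inner_self[OF 2]]]]])
       (simp add: smooth_energy_slope_def field_simps)
qed

lemma \<epsilon>_deriv_nonpos:
  assumes t: "t0 < t"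
  shows "deriv_from t0 \<epsilon> t \<le> 0"
proof -
  have "mono_on {t0..} (\<lambda>s. - \<epsilon> s)"
    using \<epsilon>_antimono by (auto simp: monotone_on_def)
  moreover have "((\<lambda>s. - \<epsilon> s) has_real_derivative - deriv_from t0 \<epsilon> t) (at t)"
    by (intro DERIV_minus C1_fromD(1)[OF \<epsilon>_C1 t])
  ultimately have "- deriv_from t0 \<epsilon> t \<ge> 0"
    by (rule mono_on_imp_deriv_nonneg) (use t in auto)
  then show ?thesis by simp
qed

text \<open>The almost everywhere derivatives of \<open>u\<close> and \<open>v\<close>.\<close>
definition u_slope :: "real \<Rightarrow> real^'n" where "u_slope t = (1 + \<theta>) *\<^sub>R x' t + (\<theta> * t) *\<^sub>R x'' t"
definition v_slope :: "real \<Rightarrow> real^'m" where "v_slope t = (1 + \<theta>) *\<^sub>R y' t + (\<theta> * t) *\<^sub>R y'' t"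

text \<open>The heart of the proof.  The extrapolated arguments \<open>y + \<theta> t y'\<close> and \<open>x + \<theta> t x'\<close> make the
  bilinear terms of the two equations cancel up to those of the gap and of its derivative, and the weight
  \<open>\<theta> t \<alpha> - \<theta> - 1\<close> on the distances cancels the mixed terms \<open>\<langle>x - xs, x'\<rangle>\<close> and \<open>\<langle>y - ys, y'\<rangle>\<close>.  Of what
  remains, every term except the source \<open>C t \<beta> \<epsilon>\<close> is nonpositive: by convexity, by the monotonicity
  of \<open>\<epsilon>\<close>, and by the three parameter conditions.\<close>
lemma energy_slope_le:
  assumes t: "t0 < t"
    and ex: "x'' t + \<alpha> t *\<^sub>R x' t
          + \<beta> t *\<^sub>R grad_x f g K \<epsilon> t (x t) (y t + (\<theta> * t) *\<^sub>R y' t) = 0"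
    and ey: "y'' t + \<alpha> t *\<^sub>R y' t
          - \<beta> t *\<^sub>R grad_y f g K \<epsilon> t (x t + (\<theta> * t) *\<^sub>R x' t) (y t) = 0"
  shows "smooth_energy_slope t + u t \<bullet> u_slope t + v t \<bullet> v_slope t \<le> energy_rate * (t * \<beta> t * \<epsilon> t)"
proof -
  define a b where "a = x t - xs" and "b = y t - ys"
  define Rx where "Rx = gradient f (x t) + adjoint ((*v) K) (y t + (\<theta> * t) *\<^sub>R y' t) + \<epsilon> t *\<^sub>R x t"
  define Ry where "Ry = gradient g (y t) - K *v (x t + (\<theta> * t) *\<^sub>R x' t) + \<epsilon> t *\<^sub>R y t"
  define c where "c = \<theta> * t * \<alpha> t - \<theta> - 1"
  define A where "A = gradient f (x t) \<bullet> a + gradient g (y t) \<bullet> b + (K *v x t) \<bullet> ys - (K *v xs) \<bullet> y t"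
  have ux: "u t = a + (\<theta> * t) *\<^sub>R x' t" and vy: "v t = b + (\<theta> * t) *\<^sub>R y' t"
    by (simp_all add: u_def v_def a_def b_def)
  have x2: "x'' t = - (\<alpha> t *\<^sub>R x' t) - \<beta> t *\<^sub>R Rx"
    using ex by (simp add: grad_x_eq[OF f_diff] Rx_def eq_neg_iff_add_eq_0 algebra_simps)
  have us: "u_slope t = - (c *\<^sub>R x' t) - (\<theta> * t * \<beta> t) *\<^sub>R Rx"
    unfolding u_slope_def c_def x2 by (simp add: algebra_simps)
  have y2: "y'' t = - (\<alpha> t *\<^sub>R y' t) - \<beta> t *\<^sub>R Ry"
    using ey by (simp add: grad_y_eq[OF g_diff] Ry_def eq_neg_iff_add_eq_0 algebra_simps)
  have vs: "v_slope t = - (c *\<^sub>R y' t) - (\<theta> * t * \<beta> t) *\<^sub>R Ry"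
    unfolding v_slope_def c_def y2 by (simp add: algebra_simps)
  have u1: "u t \<bullet> u_slope t = - c * (a \<bullet> x' t) - c * \<theta> * t * (x' t \<bullet> x' t) - \<theta> * t * \<beta> t * (u t \<bullet> Rx)"
    unfolding us by (simp add: ux inner_diff_right inner_add_left algebra_simps)
  have v1: "v t \<bullet> v_slope t = - c * (b \<bullet> y' t) - c * \<theta> * t * (y' t \<bullet> y' t) - \<theta> * t * \<beta> t * (v t \<bullet> Ry)"
    unfolding vs by (simp add: vy inner_diff_right inner_add_left algebra_simps)
  have adj: "z \<bullet> adjoint ((*v) K) w = (K *v z) \<bullet> w" for z w
    by (simp add: adjoint_works)
  have R: "u t \<bullet> Rx + v t \<bullet> Ry = A + \<epsilon> t * (x t \<bullet> a + y t \<bullet> b)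
      + \<theta> * t * (gap_slope t + \<epsilon> t * (x t \<bullet> x' t + y t \<bullet> y' t))"
    unfolding ux vy Rx_def Ry_def A_def gap_slope_def a_def b_def
    by (simp add: inner_add_left inner_add_right inner_diff_left inner_diff_right adj
        matrix_vector_right_distrib matrix_vector_mult_diff_distrib matrix_vector_mult_scaleR
        inner_commute algebra_simps)
  have xa: "x t \<bullet> a = (x t \<bullet> x t + a \<bullet> a - xs \<bullet> xs) / 2"
    and yb: "y t \<bullet> b = (y t \<bullet> y t + b \<bullet> b - ys \<bullet> ys) / 2"
    by (simp_all add: a_def b_def inner_diff_left inner_diff_right inner_commute)
  have gap_le: "gap t \<le> A"
    using convex_on_gradient_ineq[OF _ f_diff, of "x t" xs] convex_on_gradient_ineq[OF _ g_diff, of "y t" ys] f g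
    unfolding C1_convex_def gap_eq A_def a_def b_def
    by (simp add: inner_diff_right)
  have signs: "t > 0" "\<beta> t > 0" "\<epsilon> t > 0" "c \<ge> 0" "deriv_from t0 \<epsilon> t \<le> 0" "reg_gap t \<ge> 0"
    "(2 * \<theta> - 1) * \<beta> t + \<theta> * t * deriv_from t0 \<beta> t \<le> 0"
    "\<alpha> t + t * deriv_from t0 \<alpha> t - t * \<beta> t * \<epsilon> t \<le> 0"
    using t t0_pos \<beta>_pos[of t] \<epsilon>_pos[of t] damping[of t] scaling[of t] damping_rate[of t] \<epsilon>_deriv_nonpos[OF t] gap_nonneg[of t]
    by (auto simp: c_def reg_gap_def)
  have "smooth_energy_slope t + u t \<bullet> u_slope t + v t \<bullet> v_slope t =
      energy_rate * (t * \<beta> t * \<epsilon> t)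
      + \<theta> * t * reg_gap t * ((2 * \<theta> - 1) * \<beta> t + \<theta> * t * deriv_from t0 \<beta> t)
      + \<theta>\<^sup>2 * t\<^sup>2 * \<beta> t / 2 * (x t \<bullet> x t + y t \<bullet> y t) * deriv_from t0 \<epsilon> t
      - c * \<theta> * t * (x' t \<bullet> x' t + y' t \<bullet> y' t)
      + \<theta> / 2 * (a \<bullet> a + b \<bullet> b) * (\<alpha> t + t * deriv_from t0 \<alpha> t - t * \<beta> t * \<epsilon> t)
      + \<theta> * t * \<beta> t * (gap t - A)"
  proof -
    have "smooth_energy_slope t + u t \<bullet> u_slope t + v t \<bullet> v_slope t =
       \<theta>\<^sup>2 * (2 * t * \<beta> t + t\<^sup>2 * deriv_from t0 \<beta> t) * reg_gap t
       + \<theta>\<^sup>2 * t\<^sup>2 * \<beta> t * reg_gap_slope t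
       + \<theta> * (\<alpha> t + t * deriv_from t0 \<alpha> t) / 2 * (a \<bullet> a + b \<bullet> b)
       - c * \<theta> * t * (x' t \<bullet> x' t + y' t \<bullet> y' t) - \<theta> * t * \<beta> t * (u t \<bullet> Rx + v t \<bullet> Ry)"
      unfolding u1 v1 smooth_energy_slope_def a_def[symmetric] b_def[symmetric] c_def[symmetric]
      by (simp add: algebra_simps)
    also have "\<theta> * t * \<beta> t * (u t \<bullet> Rx + v t \<bullet> Ry) =
        \<theta> * t * \<beta> t * (A - gap t) + \<theta> * t * \<beta> t * reg_gap t
        + \<theta> / 2 * t * \<beta> t * \<epsilon> t * (a \<bullet> a + b \<bullet> b) - energy_rate * (t * \<beta> t * \<epsilon> t)
        + \<theta>\<^sup>2 * t\<^sup>2 * \<beta> t * (gap_slope t + \<epsilon> t * (x t \<bullet> x' t + y t \<bullet> y' t))"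
      unfolding R xa yb reg_gap_def energy_rate_def by (simp add: field_simps power2_eq_square)
    finally show ?thesis
      unfolding reg_gap_slope_def by (simp add: field_simps power2_eq_square)
  qed
  moreover have "\<theta> * t * reg_gap t * ((2 * \<theta> - 1) * \<beta> t + \<theta> * t * deriv_from t0 \<beta> t) \<le> 0"
    using signs \<theta>_pos by (intro mult_nonneg_nonpos) auto
  moreover have "\<theta>\<^sup>2 * t\<^sup>2 * \<beta> t / 2 * (x t \<bullet> x t + y t \<bullet> y t) * deriv_from t0 \<epsilon> t \<le> 0"
    using signs by (intro mult_nonneg_nonpos) auto
  moreover have "c * \<theta> * t * (x' t \<bullet> x' t + y' t \<bullet> y' t) \<ge> 0"
    using signs \<theta>_pos by auto
  moreover have "\<theta> / 2 * (a \<bullet> a + b \<bullet> b) * (\<alpha> t + t * deriv_from t0 \<alpha> t - t * \<beta> t * \<epsilon> t) \<le> 0"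
    using signs \<theta>_pos by (intro mult_nonneg_nonpos) auto
  moreover have "\<theta> * t * \<beta> t * (gap t - A) \<le> 0"
    using signs \<theta>_pos gap_le by (intro mult_nonneg_nonpos) auto
  ultimately show ?thesis by linarith
qed

lemma energy_increment_le:
  assumes ab: "t0 < a" "a \<le> b"
  shows "energy b - energy a \<le> energy_rate * integral {a..b} (\<lambda>t. t * \<beta> t * \<epsilon> t)"
proof (rule AE_has_integral_le)
  have "(smooth_energy_slope has_integral smooth_energy b - smooth_energy a) {a..b}"
    using ab by (intro fundamental_theorem_of_calculus)
      (auto simp flip: has_real_derivative_iff_has_vector_derivative
        intro!: has_field_derivative_at_within[OF smooth_energy_deriv])
  from has_integral_add[OF has_integral_add[OF this
      W21_loc_half_norm_has_integral[OF x_W21 ab, of xs \<theta>]]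
      W21_loc_half_norm_has_integral[OF y_W21 ab, of ys \<theta>]]
  show "((\<lambda>t. smooth_energy_slope t + u t \<bullet> u_slope t + v t \<bullet> v_slope t) has_integral energy b - energy a) {a..b}"
    unfolding u_slope_def v_slope_def u_def[symmetric] v_def[symmetric] energy_def
    by (simp add: algebra_simps)
  have "continuous_on {a..b} \<beta>" "continuous_on {a..b} \<epsilon>"
    by (rule continuous_on_subset[OF C1_fromD(2)[OF \<beta>_C1]], use ab in force)
       (rule continuous_on_subset[OF C1_fromD(2)[OF \<epsilon>_C1]], use ab in force)
  then have "(\<lambda>t. t * \<beta> t * \<epsilon> t) integrable_on {a..b}"
    by (intro integrable_continuous_real continuous_intros)
  then show "((\<lambda>t. energy_rate * (t * \<beta> t * \<epsilon> t)) has_integral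
      energy_rate * integral {a..b} (\<lambda>t. t * \<beta> t * \<epsilon> t)) {a..b}"
    by (intro has_integral_mult_right integrable_integral)
  have "AE t in lebesgue. t > t0 \<longrightarrow>
      smooth_energy_slope t + u t \<bullet> u_slope t + v t \<bullet> v_slope t \<le> energy_rate * (t * \<beta> t * \<epsilon> t)"
    using trajectory unfolding GTRD_trajectory_def
    by (auto elim!: eventually_mono intro!: energy_slope_le)
  then show "AE t in lebesgue. t \<in> {a..b} \<longrightarrow>
      smooth_energy_slope t + u t \<bullet> u_slope t + v t \<bullet> v_slope t \<le> energy_rate * (t * \<beta> t * \<epsilon> t)"
    by eventually_elim (use ab in auto)
qed

lemma energy_parts:
  assumes t: "t0 < t"
  shows "\<theta>\<^sup>2 * t\<^sup>2 * (\<beta> t * gap t) \<le> energy t"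
    and "(norm (u t))\<^sup>2 \<le> 2 * energy t" and "(norm (v t))\<^sup>2 \<le> 2 * energy t"
    and "(\<theta> * t * \<alpha> t - \<theta> - 1) * (norm (x t - xs))\<^sup>2 \<le> 2 * energy t"
    and "(\<theta> * t * \<alpha> t - \<theta> - 1) * (norm (y t - ys))\<^sup>2 \<le> 2 * energy t"
    and "0 \<le> energy t"
proof -
  define c where "c = \<theta> * t * \<alpha> t - \<theta> - 1"
  have s: "\<beta> t > 0" "\<epsilon> t > 0" "c \<ge> 0"
    using t \<beta>_pos[of t] \<epsilon>_pos[of t] damping[of t] by (auto simp: c_def)
  have "\<beta> t * gap t \<le> \<beta> t * reg_gap t"
    using s by (intro mult_left_mono) (auto simp: reg_gap_def)
  from mult_left_mono[OF this, of "\<theta>\<^sup>2 * t\<^sup>2"]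
  have 1: "\<theta>\<^sup>2 * t\<^sup>2 * (\<beta> t * gap t) \<le> \<theta>\<^sup>2 * t\<^sup>2 * \<beta> t * reg_gap t"
    by (simp add: mult.assoc)
  have 2: "0 \<le> \<theta>\<^sup>2 * t\<^sup>2 * (\<beta> t * gap t)"
    using s gap_nonneg[of t] by simp
  have 3: "0 \<le> c * (norm (x t - xs))\<^sup>2" "0 \<le> c * (norm (y t - ys))\<^sup>2"
    using s by auto
  have 4: "energy t = \<theta>\<^sup>2 * t\<^sup>2 * \<beta> t * reg_gap t + c * (norm (x t - xs))\<^sup>2 / 2 + c * (norm (y t - ys))\<^sup>2 / 2
      + (norm (u t))\<^sup>2 / 2 + (norm (v t))\<^sup>2 / 2"
    unfolding energy_def smooth_energy_def c_def power2_norm_eq_inner by (simp add: field_simps)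
  have 5: "0 \<le> (norm (u t))\<^sup>2" "0 \<le> (norm (v t))\<^sup>2" by auto
  show "\<theta>\<^sup>2 * t\<^sup>2 * (\<beta> t * gap t) \<le> energy t" "(norm (u t))\<^sup>2 \<le> 2 * energy t" "(norm (v t))\<^sup>2 \<le> 2 * energy t"
    "(\<theta> * t * \<alpha> t - \<theta> - 1) * (norm (x t - xs))\<^sup>2 \<le> 2 * energy t"
    "(\<theta> * t * \<alpha> t - \<theta> - 1) * (norm (y t - ys))\<^sup>2 \<le> 2 * energy t" "0 \<le> energy t"
    unfolding c_def[symmetric] using 1 2 3 4 5 by linarith+
qed

text \<open>With \<open>h = \<beta> \<epsilon> / t\<close> the source of the energy inequality is \<open>C t\<^sup>2 h\<close>, so that
  \<open>energy t \<le> energy T + C t\<^sup>2 \<integral>h\<close> with the integral over \<open>[T, t]\<close>; the tail of \<open>\<integral>h\<close> is small.\<close>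
lemma energy_over_square_tendsto_0: "((\<lambda>t. energy t / t\<^sup>2) \<longlongrightarrow> 0) at_top"
proof (rule tendstoI)
  fix e :: real assume e: "e > 0"
  define h where "h t = \<beta> t * \<epsilon> t / t" for t
  define d where "d = e / 3 / (energy_rate + 1)"
  have d: "d > 0" "energy_rate * d \<le> e / 3"
    using e energy_rate_nonneg by (auto simp: d_def field_simps)
  have hi: "h absolutely_integrable_on {t0..}"
    using integrable by (simp add: h_def [abs_def])
  have h0: "0 \<le> h t" if "t0 \<le> t" for t
    using \<beta>_pos[OF that] \<epsilon>_pos[OF that] that t0_pos by (simp add: h_def)
  obtain T where T: "T > t0" "\<And>t. T \<le> t \<Longrightarrow> integral {T..t} h \<le> d"
    using tail_integral_le[OF hi h0 d(1)] by blast
  have growth: "energy t \<le> energy T + t\<^sup>2 * (e / 3)" if t: "T \<le> t" for t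
  proof -
    have i: "h integrable_on {T..t}"
      by (rule integrable_on_subinterval[of _ "{t0..}"]) (use hi T t in \<open>auto simp: absolutely_integrable_on_def\<close>)
    have c: "continuous_on {T..t} \<beta>" "continuous_on {T..t} \<epsilon>"
      by (rule continuous_on_subset[OF C1_fromD(2)[OF \<beta>_C1]], use T in force)
         (rule continuous_on_subset[OF C1_fromD(2)[OF \<epsilon>_C1]], use T in force)
    have "integral {T..t} (\<lambda>s. s * \<beta> s * \<epsilon> s) \<le> integral {T..t} (\<lambda>s. t\<^sup>2 * h s)"
    proof (rule integral_le)
      show "(\<lambda>s. s * \<beta> s * \<epsilon> s) integrable_on {T..t}"
        by (intro integrable_continuous_real continuous_intros c)
      show "(\<lambda>s. t\<^sup>2 * h s) integrable_on {T..t}"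
        by (intro integrable_on_mult_right i)
      fix s assume s: "s \<in> {T..t}"
      have "s * \<beta> s * \<epsilon> s = s\<^sup>2 * h s"
        using s T t0_pos by (simp add: h_def power2_eq_square)
      also have "\<dots> \<le> t\<^sup>2 * h s"
        using s T t0_pos by (intro mult_right_mono power_mono h0) auto
      finally show "s * \<beta> s * \<epsilon> s \<le> t\<^sup>2 * h s" .
    qed
    also have "\<dots> = t\<^sup>2 * integral {T..t} h"
      by simp
    also have "\<dots> \<le> t\<^sup>2 * d"
      by (intro mult_left_mono T(2) t) simp
    finally have "energy_rate * integral {T..t} (\<lambda>s. s * \<beta> s * \<epsilon> s) \<le> energy_rate * (t\<^sup>2 * d)"
      using energy_rate_nonneg by (rule mult_left_mono)
    also have "\<dots> \<le> t\<^sup>2 * (e / 3)"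
      using mult_left_mono[OF d(2), of "t\<^sup>2"] by (simp add: mult_ac)
    finally show ?thesis
      using energy_increment_le[OF T(1) t] by linarith
  qed
  have "((\<lambda>t. energy T / t\<^sup>2) \<longlongrightarrow> 0) at_top"
    by (intro tendsto_divide_0[OF tendsto_const] filterlim_at_top_imp_at_infinity filterlim_pow_at_top filterlim_ident) auto
  then have "\<forall>\<^sub>F t in at_top. energy T / t\<^sup>2 < e / 3"
    using e by (intro order_tendstoD) auto
  then show "\<forall>\<^sub>F t in at_top. dist (energy t / t\<^sup>2) 0 < e"
    using eventually_ge_at_top[of T]
  proof eventually_elim
    case (elim t)
    have t: "t > 0" "t > t0" using elim T t0_pos by auto
    have "energy t / t\<^sup>2 \<le> energy T / t\<^sup>2 + e / 3"
      using growth[OF elim(2)] t by (simp add: field_simps)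
    then have "energy t / t\<^sup>2 < e"
      using elim(1) e by linarith
    then show ?case
      using energy_parts(6)[OF t(2)] by (simp add: dist_real_def)
  qed
qed

lemma scaled_gap_tendsto_0: "((\<lambda>t. \<beta> t * gap t) \<longlongrightarrow> 0) at_top"
proof (rule tendsto_sandwich[OF _ _ tendsto_const])
  show "((\<lambda>t. inverse (\<theta>\<^sup>2) * (energy t / t\<^sup>2)) \<longlongrightarrow> 0) at_top"
    by (rule tendsto_mult_right_zero[OF energy_over_square_tendsto_0])
  show "\<forall>\<^sub>F t in at_top. \<beta> t * gap t \<le> inverse (\<theta>\<^sup>2) * (energy t / t\<^sup>2)"
    using eventually_gt_at_top[of t0]
  proof eventually_elim
    case (elim t)
    have "t > 0" using elim t0_pos by simp
    then show ?case
      using energy_parts(1)[OF elim] \<theta>_pos by (simp add: field_simps)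
  qed
  show "\<forall>\<^sub>F t in at_top. 0 \<le> \<beta> t * gap t"
    using eventually_ge_at_top[of t0]
    by eventually_elim (simp add: gap_nonneg \<beta>_pos[THEN less_imp_le])
qed

section \<open>Asymptotic consequences\<close>

lemma norm_over_t_tendsto_0:
  fixes w :: "real \<Rightarrow> 'a::real_normed_vector"
  assumes w: "\<And>t. t0 < t \<Longrightarrow> (norm (w t))\<^sup>2 \<le> C * energy t"
  shows "((\<lambda>t. norm (w t) / t) \<longlongrightarrow> 0) at_top"
proof (rule tendsto_sandwich[OF _ _ tendsto_const])
  show "((\<lambda>t. sqrt (C * (energy t / t\<^sup>2))) \<longlongrightarrow> 0) at_top"
    using tendsto_real_sqrt[OF tendsto_mult_right_zero[OF energy_over_square_tendsto_0, of C]] by simp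
  show "\<forall>\<^sub>F t in at_top. norm (w t) / t \<le> sqrt (C * (energy t / t\<^sup>2))"
    using eventually_gt_at_top[of t0]
  proof eventually_elim
    case (elim t)
    have "t > 0" using elim t0_pos by simp
    then have "(norm (w t) / t)\<^sup>2 \<le> C * (energy t / t\<^sup>2)"
      using w[OF elim] by (simp add: power_divide divide_right_mono)
    then show ?case by (rule real_le_rsqrt)
  qed
  show "\<forall>\<^sub>F t in at_top. 0 \<le> norm (w t) / t"
    using eventually_ge_at_top[of 0] by eventually_elim simp
qed

lemma velocity_tendsto_0:
  fixes p w :: "real \<Rightarrow> 'a::real_normed_vector"
  assumes p: "\<And>t. t0 < t \<Longrightarrow> (norm (p t))\<^sup>2 \<le> C * energy t"
    and w: "\<And>t. t0 < t \<Longrightarrow> (norm (p t + (\<theta> * t) *\<^sub>R w t))\<^sup>2 \<le> D * energy t"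
  shows "((\<lambda>t. norm (w t)) \<longlongrightarrow> 0) at_top"
proof (rule tendsto_sandwich[OF _ _ tendsto_const])
  show "((\<lambda>t. inverse \<theta> * (norm (p t + (\<theta> * t) *\<^sub>R w t) / t + norm (p t) / t)) \<longlongrightarrow> 0) at_top"
    using tendsto_mult_right_zero[OF tendsto_add_zero[OF norm_over_t_tendsto_0[OF w] norm_over_t_tendsto_0[OF p]]]
    by blast
  show "\<forall>\<^sub>F t in at_top. norm (w t) \<le> inverse \<theta> * (norm (p t + (\<theta> * t) *\<^sub>R w t) / t + norm (p t) / t)"
    using eventually_gt_at_top[of t0]
  proof eventually_elim
    case (elim t)
    have t: "t > 0" using elim t0_pos by simp
    have "norm ((\<theta> * t) *\<^sub>R w t) \<le> norm (p t + (\<theta> * t) *\<^sub>R w t) + norm (p t)"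
      using norm_triangle_ineq4[of "p t + (\<theta> * t) *\<^sub>R w t" "p t"] by simp
    then have "\<theta> * t * norm (w t) \<le> norm (p t + (\<theta> * t) *\<^sub>R w t) + norm (p t)"
      using t \<theta>_pos by simp
    then show ?case
      using t \<theta>_pos by (simp add: field_simps)
  qed
qed auto

end

lemma smallo_inverse_sqrt:
  fixes w gap :: "real \<Rightarrow> real"
  assumes "((\<lambda>t. \<beta> t * gap t) \<longlongrightarrow> 0) at_top" and \<beta>: "filterlim \<beta> at_top at_top"
    and w: "\<And>t. (w t)\<^sup>2 \<le> C * gap t" "\<And>t. 0 \<le> w t"
  shows "w \<in> o[at_top](\<lambda>t. 1 / sqrt (\<beta> t))"
proof (rule smalloI_tendsto)
  have pos: "\<forall>\<^sub>F t in at_top. \<beta> t > 0"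
    using \<beta> by (simp add: filterlim_at_top_dense)
  show "\<forall>\<^sub>F t in at_top. 1 / sqrt (\<beta> t) \<noteq> 0"
    using pos by eventually_elim simp
  show "((\<lambda>t. w t / (1 / sqrt (\<beta> t))) \<longlongrightarrow> 0) at_top"
  proof (rule tendsto_sandwich[OF _ _ tendsto_const])
    show "((\<lambda>t. sqrt (C * (\<beta> t * gap t))) \<longlongrightarrow> 0) at_top"
      using tendsto_real_sqrt[OF tendsto_mult_right_zero[OF assms(1), of C]] by simp
    show "\<forall>\<^sub>F t in at_top. w t / (1 / sqrt (\<beta> t)) \<le> sqrt (C * (\<beta> t * gap t))"
      using pos
    proof eventually_elim
      case (elim t)
      have "(w t * sqrt (\<beta> t))\<^sup>2 \<le> C * (\<beta> t * gap t)"
        using mult_right_mono[OF w(1)[of t], of "\<beta> t"] elim by (simp add: power_mult_distrib mult_ac)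
      then show ?case
        by (simp add: real_le_rsqrt)
    qed
    show "\<forall>\<^sub>F t in at_top. 0 \<le> w t / (1 / sqrt (\<beta> t))"
      using pos by eventually_elim (simp add: w(2))
  qed
qed

lemma tendsto_0_of_Liminf_pos:
  fixes \<beta> gap :: "real \<Rightarrow> real"
  assumes lim: "((\<lambda>t. \<beta> t * gap t) \<longlongrightarrow> 0) at_top" and "Liminf at_top (\<lambda>t. ereal (\<beta> t)) > 0"
    and gap: "\<And>t. 0 \<le> gap t"
  shows "(gap \<longlongrightarrow> 0) at_top"
proof -
  obtain c where c: "0 < ereal c" "ereal c < Liminf at_top (\<lambda>t. ereal (\<beta> t))"
    using ereal_dense2[OF assms(2)] by auto
  have ev: "\<forall>\<^sub>F t in at_top. c < \<beta> t"
    using less_LiminfD[OF c(2)] by simp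
  show ?thesis
  proof (rule tendsto_sandwich[OF _ _ tendsto_const])
    show "((\<lambda>t. inverse c * (\<beta> t * gap t)) \<longlongrightarrow> 0) at_top"
      by (rule tendsto_mult_right_zero[OF lim])
    show "\<forall>\<^sub>F t in at_top. gap t \<le> inverse c * (\<beta> t * gap t)"
      using ev
    proof eventually_elim
      case (elim t)
      have "c * gap t \<le> \<beta> t * gap t"
        using elim gap[of t] by (intro mult_right_mono) auto
      then show ?case using c(1) by (simp add: field_simps)
    qed
  qed (simp add: gap)
qed

theorem theorem3p2:
  fixes f :: "real^'n \<Rightarrow> real" and g :: "real^'m \<Rightarrow> real" and K :: "real^'n^'m"
    and \<alpha> \<beta> \<epsilon> :: "real \<Rightarrow> real" and \<theta> t0 L1 L2 :: real
    and x x' x'' :: "real \<Rightarrow> real^'n" and y y' y'' :: "real \<Rightarrow> real^'m"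
    and xs :: "real^'n" and ys :: "real^'m"
  assumes "C1_convex f" and "C1_convex g"
    and "L1 > 0" and "L2 > 0"
    and "L1-lipschitz_on UNIV (gradient f)" and "L2-lipschitz_on UNIV (gradient g)"
    and "t0 > 0" and "\<theta> > 0"
    and "C1_from t0 \<alpha>" and "C1_from t0 \<beta>" and "C1_from t0 \<epsilon>"
    and "\<And>t. t \<ge> t0 \<Longrightarrow> \<alpha> t > 0" and "\<And>t. t \<ge> t0 \<Longrightarrow> \<beta> t > 0"
    and "\<And>t. t \<ge> t0 \<Longrightarrow> \<epsilon> t > 0"
    and "antimono_on {t0..} \<epsilon>" and "(\<epsilon> \<longlongrightarrow> 0) at_top"
    and "\<And>t. t \<ge> t0 \<Longrightarrow> 1 + \<theta> - \<theta> * t * \<alpha> t \<le> 0"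
    and "\<And>t. t \<ge> t0 \<Longrightarrow> (2 * \<theta> - 1) * \<beta> t + \<theta> * t * deriv_from t0 \<beta> t \<le> 0"
    and "\<And>t. t \<ge> t0 \<Longrightarrow> \<alpha> t + t * deriv_from t0 \<alpha> t \<le> t * \<beta> t * \<epsilon> t"
    and "(\<lambda>t. \<beta> t * \<epsilon> t / t) absolutely_integrable_on {t0..}"
    and "GTRD_trajectory f g K \<alpha> \<beta> \<epsilon> \<theta> t0 x x' x'' y y' y''"
    and "(xs, ys) \<in> saddle_points f g K"
  shows
    "((\<exists>D2>0. \<forall>t\<ge>t0. D2 \<le> \<theta> * t * \<alpha> t - \<theta> - 1) \<longrightarrow>
        ((\<lambda>t. norm (x' t)) \<longlongrightarrow> 0) at_top \<and> ((\<lambda>t. norm (y' t)) \<longlongrightarrow> 0) at_top) \<and>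
     (Liminf at_top (\<lambda>t. ereal (\<beta> t)) > 0 \<longrightarrow>
        ((\<lambda>t. lagrangian f g K (x t) ys - lagrangian f g K xs (y t)) \<longlongrightarrow> 0) at_top) \<and>
     (filterlim \<beta> at_top at_top \<longrightarrow>
        (\<lambda>t. lagrangian f g K (x t) ys - lagrangian f g K xs (y t)) \<in> o[at_top](\<lambda>t. 1 / \<beta> t) \<and>
        (\<lambda>t. norm (gradient f (x t) - gradient f xs)) \<in> o[at_top](\<lambda>t. 1 / sqrt (\<beta> t)) \<and>
        (\<lambda>t. norm (gradient g (y t) - gradient g ys)) \<in> o[at_top](\<lambda>t. 1 / sqrt (\<beta> t)))"
proof -
  interpret gtrd f g K \<alpha> \<beta> \<epsilon> \<theta> t0 x x' x'' y y' y'' xs ys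
    by unfold_locales (fact assms)+
  have gap: "(\<lambda>t. lagrangian f g K (x t) ys - lagrangian f g K xs (y t)) = gap"
    by (simp add: gap_def [abs_def])
  have saddle_le: "lagrangian f g K xs (y t) \<le> lagrangian f g K xs ys"
      "lagrangian f g K xs ys \<le> lagrangian f g K (x t) ys"
      "lagrangian f g K xs ys \<le> lagrangian f g K z ys"
      "lagrangian f g K xs w \<le> lagrangian f g K xs ys" for t z w
    using assms(22) by (auto simp: saddle_points_def)
  have velocity: "((\<lambda>t. norm (x' t)) \<longlongrightarrow> 0) at_top \<and> ((\<lambda>t. norm (y' t)) \<longlongrightarrow> 0) at_top"
    if D2: "D2 > 0" "\<And>t. t \<ge> t0 \<Longrightarrow> D2 \<le> \<theta> * t * \<alpha> t - \<theta> - 1" for D2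
  proof
    have dist: "r\<^sup>2 \<le> (2 / D2) * energy t"
      if "t0 < t" "(\<theta> * t * \<alpha> t - \<theta> - 1) * r\<^sup>2 \<le> 2 * energy t" for t r
    proof -
      have "D2 * r\<^sup>2 \<le> (\<theta> * t * \<alpha> t - \<theta> - 1) * r\<^sup>2"
        using D2(2)[of t] that by (intro mult_right_mono) auto
      then show ?thesis
        using that D2(1) by (simp add: field_simps)
    qed
    show "((\<lambda>t. norm (x' t)) \<longlongrightarrow> 0) at_top"
      by (rule velocity_tendsto_0[of "\<lambda>t. x t - xs" "2 / D2" _ 2])
         (use dist energy_parts(4) energy_parts(2) in \<open>auto simp: u_def\<close>)
    show "((\<lambda>t. norm (y' t)) \<longlongrightarrow> 0) at_top"
      by (rule velocity_tendsto_0[of "\<lambda>t. y t - ys" "2 / D2" _ 2])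
         (use dist energy_parts(5) energy_parts(3) in \<open>auto simp: v_def\<close>)
  qed
  have gap_o: "(\<lambda>t. gap t) \<in> o[at_top](\<lambda>t. 1 / \<beta> t)" if "filterlim \<beta> at_top at_top"
  proof (rule smalloI_tendsto)
    show "((\<lambda>t. gap t / (1 / \<beta> t)) \<longlongrightarrow> 0) at_top"
      using scaled_gap_tendsto_0 by (simp add: mult.commute)
    have "\<forall>\<^sub>F t in at_top. \<beta> t > 0"
      using that by (simp add: filterlim_at_top_dense)
    then show "\<forall>\<^sub>F t in at_top. 1 / \<beta> t \<noteq> 0"
      by eventually_elim simp
  qed
  have grad_f: "(norm (gradient f (x t) - gradient f xs))\<^sup>2 \<le> (2 * L1) * gap t" for t
  proof -
    have c: "adjoint ((*v) K) ys \<bullet> z = (K *v z) \<bullet> ys" for z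
      by (metis adjoint_works inner_commute matrix_vector_mul_linear)
    have "(norm (gradient f (x t) - gradient f xs))\<^sup>2
        \<le> 2 * L1 * (f (x t) + adjoint ((*v) K) ys \<bullet> x t - (f xs + adjoint ((*v) K) ys \<bullet> xs))"
      by (rule norm_gradient_le_gap[OF f_diff assms(5,3)])
         (use saddle_le(3) in \<open>simp add: c lagrangian_def\<close>)
    also have "\<dots> \<le> (2 * L1) * gap t"
      using saddle_le(1)[of t] assms(3)
      by (intro mult_left_mono) (auto simp: c gap_def lagrangian_def)
    finally show ?thesis .
  qed
  have grad_g: "(norm (gradient g (y t) - gradient g ys))\<^sup>2 \<le> (2 * L2) * gap t" for t
  proof -
    have "(norm (gradient g (y t) - gradient g ys))\<^sup>2
        \<le> 2 * L2 * (g (y t) + (- (K *v xs)) \<bullet> y t - (g ys + (- (K *v xs)) \<bullet> ys))"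
      by (rule norm_gradient_le_gap[OF g_diff assms(6,4)])
         (use saddle_le(4) in \<open>simp add: lagrangian_def algebra_simps\<close>)
    also have "\<dots> \<le> (2 * L2) * gap t"
      using saddle_le(2)[of t] assms(4)
      by (intro mult_left_mono) (auto simp: gap_def lagrangian_def)
    finally show ?thesis .
  qed
  show ?thesis
    unfolding gap
    using velocity tendsto_0_of_Liminf_pos[OF scaled_gap_tendsto_0 _ gap_nonneg] gap_o
      smallo_inverse_sqrt[OF scaled_gap_tendsto_0 _ grad_f norm_ge_zero]
      smallo_inverse_sqrt[OF scaled_gap_tendsto_0 _ grad_g norm_ge_zero]
    by blast
qed

end
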